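(* Let $X\subseteq\{0,1\}^m$ and let $f\colon X\to\{0,1\}$ be a (possibly partial) Boolean function. There is a universal constant $c_1>0$ such that for every success probability $\gamma$ with $\frac12<\gamma<1$ and every integer $n\ge 1$, \[ \mathrm{R}_{\gamma^n}(f^n)\;\ge\; c_1\, n\cdot \overline{\overline{\mathrm{R}}}_\gamma(f). \] Moreover, this is best possible for large $n$: there are universal constants $c,C>0$ such that for every such $f$, every $\gamma$ with $\frac12<\gamma<1$, and every $n\ge \frac{c}{(\min\{2\gamma-1,\,1-\gamma\})^2}$, \[ \mathrm{R}_{\gamma^n}(f^n)\;\le\; C\, n\cdot \overline{\overline{\mathrm{R}}}_\gamma(f). \]
   Context: Query model: a deterministic decision tree on inputs from a set $Y\subseteq\{0,1\}^N$ queries input bits adaptively; each leaf is labelled with an output. For an input $x$ and tree $D$, $D(x)$ is the leaf reached and $\mathrm{cost}(D(x))$ its depth (number of queries). A randomized algorithm $R$ is a probability distribution over deterministic decision trees. The $n$-fold direct product $f^n\colon X^n\to\{0,1\}^n$ is $f^n(x^{(1)},\dots,x^{(n)})=(f(x^{(1)}),\dots,f(x^{(n)}))$; algorithms for $f^n$ have leaves labelled by strings in $\{0,1\}^n$. Worst-case randomized query complexity: for a function $g$ on domain $Y$, $\mathrm{R}_\gamma(g)$ is the minimum, over randomized algorithms $R$ such that for every $x\in Y$, $\Pr_{D\sim R}[D \text{ outputs } g(x) \text{ on } x]\ge\gamma$, of $\max_{x\in Y,\,D\in\mathrm{supp}(R)}\mathrm{cost}(D(x))$. Maximum distributional complexity: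 $\overline{\overline{\mathrm{R}}}_\gamma(f)=\max_\mu \min_R \mathbb{E}_{x\sim\mu,D\sim R}[\mathrm{cost}(D(x))]$, where $\mu$ ranges over distributions on $X$ and $R$ ranges over randomized algorithms with $\Pr_{x\sim\mu,D\sim R}[D\text{ outputs } f(x) \text{ on } x]\ge\gamma$ (both cost and success measured in expectation over the input $x\sim\mu$ and the internal randomness). *)

theory Defs
  imports "HOL-Probability.Probability"
begin

text \<open>
  Bit strings over a finite index set \<open>I\<close> are the elements of \<open>I \<rightarrow>\<^sub>E (UNIV :: bool set)\<close>.
  In \<open>Query i l r\<close> the subtree \<open>l\<close> is taken on answer \<open>False\<close> and \<open>r\<close> on answer \<open>True\<close>.
\<close>

datatype (queries: 'i, labels: 'o) dtree =
  Answer 'o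
| Query 'i "('i, 'o) dtree" "('i, 'o) dtree"

primrec dt_output :: "('i, 'o) dtree \<Rightarrow> ('i \<Rightarrow> bool) \<Rightarrow> 'o" where
  "dt_output (Answer a) x = a"
| "dt_output (Query i l r) x = (if x i then dt_output r x else dt_output l x)"

primrec dt_cost :: "('i, 'o) dtree \<Rightarrow> ('i \<Rightarrow> bool) \<Rightarrow> nat" where
  "dt_cost (Answer a) x = 0"
| "dt_cost (Query i l r) x = Suc (if x i then dt_cost r x else dt_cost l x)"

definition rand_algs :: "'i set \<Rightarrow> 'o set \<Rightarrow> ('i, 'o) dtree pmf set" where
  "rand_algs I L = {R. \<forall>D\<in>set_pmf R. queries D \<subseteq> I \<and> labels D \<subseteq> L}"

text \<open>
  Both complexities take values in \<open>ennreal\<close>: a distribution may have infinite support, so its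
  worst-case or expected cost may be infinite, and suprema over an empty domain are \<open>0\<close>.
\<close>

definition worst_case_R ::
  "'i set \<Rightarrow> 'o set \<Rightarrow> ('i \<Rightarrow> bool) set \<Rightarrow> (('i \<Rightarrow> bool) \<Rightarrow> 'o) \<Rightarrow> real \<Rightarrow> ennreal" where
  "worst_case_R I L Y g \<gamma> =
     (INF R \<in> {R \<in> rand_algs I L.
                 \<forall>x\<in>Y. measure_pmf.prob R {D. dt_output D x = g x} \<ge> \<gamma>}.
        SUP x\<in>Y. SUP D\<in>set_pmf R. of_nat (dt_cost D x))"

definition max_dist_R ::
  "'i set \<Rightarrow> 'o set \<Rightarrow> ('i \<Rightarrow> bool) set \<Rightarrow> (('i \<Rightarrow> bool) \<Rightarrow> 'o) \<Rightarrow> real \<Rightarrow> ennreal" where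
  "max_dist_R I L Y g \<gamma> =
     (SUP \<mu> \<in> {\<mu>. set_pmf \<mu> \<subseteq> Y}.
        INF R \<in> {R \<in> rand_algs I L.
                   measure_pmf.prob (pair_pmf \<mu> R) {(x, D). dt_output D x = g x} \<ge> \<gamma>}.
          \<integral>\<^sup>+ (x, D). of_nat (dt_cost D x) \<partial>measure_pmf (pair_pmf \<mu> R))"

text \<open>
  An input of the \<open>n\<close>-fold product is a bit string over \<open>{..<n} \<times> {..<m}\<close>; bit \<open>(k, i)\<close> is bit \<open>i\<close>
  of the \<open>k\<close>-th component.
\<close>

definition block :: "nat \<Rightarrow> (nat \<times> nat \<Rightarrow> bool) \<Rightarrow> nat \<Rightarrow> (nat \<Rightarrow> bool)" where
  "block m z k = (\<lambda>i\<in>{..<m}. z (k, i))"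

definition power_dom :: "nat \<Rightarrow> nat \<Rightarrow> (nat \<Rightarrow> bool) set \<Rightarrow> (nat \<times> nat \<Rightarrow> bool) set" where
  "power_dom m n X = {z \<in> {..<n} \<times> {..<m} \<rightarrow>\<^sub>E UNIV. \<forall>k<n. block m z k \<in> X}"

definition direct_product ::
  "nat \<Rightarrow> nat \<Rightarrow> ((nat \<Rightarrow> bool) \<Rightarrow> bool) \<Rightarrow> (nat \<times> nat \<Rightarrow> bool) \<Rightarrow> (nat \<Rightarrow> bool)" where
  "direct_product m n f z = (\<lambda>k\<in>{..<n}. f (block m z k))"

definition R_single ::
  "nat \<Rightarrow> (nat \<Rightarrow> bool) set \<Rightarrow> ((nat \<Rightarrow> bool) \<Rightarrow> bool) \<Rightarrow> real \<Rightarrow> ennreal" where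
  "R_single m X f \<gamma> = max_dist_R {..<m} UNIV X f \<gamma>"

definition R_power ::
  "nat \<Rightarrow> nat \<Rightarrow> (nat \<Rightarrow> bool) set \<Rightarrow> ((nat \<Rightarrow> bool) \<Rightarrow> bool) \<Rightarrow> real \<Rightarrow> ennreal" where
  "R_power m n X f \<gamma> =
     worst_case_R ({..<n} \<times> {..<m}) ({..<n} \<rightarrow>\<^sub>E UNIV) (power_dom m n X) (direct_product m n f) \<gamma>"

end

theory Submission imports Defs begin

text \<open>
  Charge a factor \<open>q = exp (- l)\<close> per query. For the discounted value \<open>E[correct * q ^ cost]\<close> the
  blocks of a product input decouple, so an algorithm for \<open>f ^ n\<close> with \<open>T\<close> queries and success
  \<open>\<gamma> ^ n\<close> yields, for every input distribution, a tree for \<open>f\<close> of discounted value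
  \<open>\<gamma> * exp (- l * T / n)\<close>. Conversely \<open>q ^ cost \<ge> 1 - l * cost\<close> shows that a distributional
  algorithm with success \<open>\<gamma>\<close> and expected cost \<open>t\<close> has discounted value at least \<open>\<gamma> - l * t\<close>.
  So both halves of the theorem start from discounted value \<open>\<gamma> - l * t\<close> against every distribution,
  with \<open>l * t\<close> a small multiple of \<open>min (\<gamma> - 1/2) (1 - \<gamma>)\<close>.

  The minimax principle makes this a worst-case guarantee. Aborting before each query with
  probability \<open>1 - q\<close> and guessing then bounds the expected cost, and a majority vote over three
  runs lifts the success probability strictly above \<open>\<gamma>\<close>, with a surplus that grows linearly with
  the expected cost on the given input. Mixing with a guess bounds the distributional complexity;
  running the algorithm block by block under a common budget solves \<open>f ^ n\<close>.
\<close>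

section \<open>Success probability and mean cost\<close>

definition success :: "('i, 'o) dtree pmf \<Rightarrow> ('i \<Rightarrow> bool) \<Rightarrow> 'o \<Rightarrow> real" where
  "success R x y = pmf (map_pmf (\<lambda>D. dt_output D x) R) y"

definition mean_cost :: "('i, 'o) dtree pmf \<Rightarrow> ('i \<Rightarrow> bool) \<Rightarrow> real" where
  "mean_cost R x = measure_pmf.expectation R (\<lambda>D. real (dt_cost D x))"

lemma success_eq_prob: "success R x y = measure_pmf.prob R {D. dt_output D x = y}"
  by (simp add: success_def pmf_map vimage_def)

lemma success_eq_expectation:
  "success R x y = measure_pmf.expectation R (\<lambda>D. of_bool (dt_output D x = y))"
proof -
  have "(\<lambda>D. of_bool (dt_output D x = y) :: real) = indicator {D. dt_output D x = y}"
    by (auto simp: fun_eq_iff indicator_def)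
  then show ?thesis by (simp add: success_eq_prob)
qed

lemma success_nonneg [simp]: "0 \<le> success R x y"
  by (simp add: success_def)

lemma success_le_1 [simp]: "success R x y \<le> 1"
  by (simp add: success_def pmf_le_1)

lemma mean_cost_nonneg [simp]: "0 \<le> mean_cost R x"
  by (simp add: mean_cost_def integral_nonneg_AE)

lemma success_return [simp]: "success (return_pmf D) x y = of_bool (dt_output D x = y)"
  by (simp add: success_def)

lemma mean_cost_return [simp]: "mean_cost (return_pmf D) x = real (dt_cost D x)"
  by (simp add: mean_cost_def)

lemma success_map_Answer [simp]: "success (map_pmf Answer p) x y = pmf p y"
  by (simp add: success_def pmf.map_comp o_def)

lemma mean_cost_map_Answer [simp]: "mean_cost (map_pmf Answer p) x = 0"
  by (simp add: mean_cost_def)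

lemma success_bind:
  "success (bind_pmf p F) x y = measure_pmf.expectation p (\<lambda>a. success (F a) x y)"
  by (simp add: success_def map_bind_pmf pmf_bind)

lemma expectation_bind_pmf_finite:
  fixes h :: "'b \<Rightarrow> real"
  assumes "finite (set_pmf p)" "\<And>a. a \<in> set_pmf p \<Longrightarrow> finite (set_pmf (F a))"
  shows "measure_pmf.expectation (bind_pmf p F) h =
    measure_pmf.expectation p (\<lambda>a. measure_pmf.expectation (F a) h)"
  by (simp add: pmf_expectation_bind[OF assms(1) assms(2)] integral_measure_pmf[OF assms(1)])

lemma mean_cost_bind:
  assumes "finite (set_pmf p)" "\<And>a. a \<in> set_pmf p \<Longrightarrow> finite (set_pmf (F a))"
  shows "mean_cost (bind_pmf p F) x = measure_pmf.expectation p (\<lambda>a. mean_cost (F a) x)"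
  unfolding mean_cost_def by (rule expectation_bind_pmf_finite[OF assms])

lemma dt_output_cong: "(\<And>i. i \<in> queries D \<Longrightarrow> x i = y i) \<Longrightarrow> dt_output D x = dt_output D y"
  by (induction D) auto

lemma dt_cost_cong: "(\<And>i. i \<in> queries D \<Longrightarrow> x i = y i) \<Longrightarrow> dt_cost D x = dt_cost D y"
  by (induction D) auto

text \<open>A randomized algorithm is a distribution over whole trees, so both subtrees are drawn,
  independently. An input follows only one of them, hence success and mean cost depend only on the
  two marginals.\<close>

definition query_pmf ::
  "'i \<Rightarrow> ('i, 'o) dtree pmf \<Rightarrow> ('i, 'o) dtree pmf \<Rightarrow> ('i, 'o) dtree pmf" where
  "query_pmf i L R = bind_pmf L (\<lambda>l. map_pmf (Query i l) R)"

lemma set_query_pmf: "set_pmf (query_pmf i L R) = (\<Union>l\<in>set_pmf L. Query i l ` set_pmf R)"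
  by (simp add: query_pmf_def)

lemma finite_query_pmf [simp]:
  "finite (set_pmf L) \<Longrightarrow> finite (set_pmf R) \<Longrightarrow> finite (set_pmf (query_pmf i L R))"
  by (simp add: set_query_pmf)

lemma success_query_pmf [simp]:
  "success (query_pmf i L R) x y = success (if x i then R else L) x y"
  by (simp add: success_def query_pmf_def map_bind_pmf pmf.map_comp o_def)
     (simp add: map_pmf_def)

lemma mean_cost_query_pmf:
  assumes "finite (set_pmf L)" "finite (set_pmf R)"
  shows "mean_cost (query_pmf i L R) x = 1 + mean_cost (if x i then R else L) x"
proof -
  have "map_pmf (\<lambda>D. dt_cost D x) (query_pmf i L R) =
      map_pmf Suc (map_pmf (\<lambda>D. dt_cost D x) (if x i then R else L))"
    by (simp add: query_pmf_def map_bind_pmf pmf.map_comp o_def) (simp add: map_pmf_def)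
  then have "measure_pmf.expectation (map_pmf (\<lambda>D. dt_cost D x) (query_pmf i L R)) real =
      measure_pmf.expectation (map_pmf Suc (map_pmf (\<lambda>D. dt_cost D x) (if x i then R else L))) real"
    by simp
  moreover have "integrable (measure_pmf (if x i then R else L)) (\<lambda>D. real (dt_cost D x))"
    using assms by (simp add: integrable_measure_pmf_finite)
  ultimately show ?thesis
    by (simp add: mean_cost_def)
qed

section \<open>Minimax by multiplicative weights\<close>

lemma exp_minus_le:
  fixes a :: real
  assumes "0 \<le> a"
  shows "exp (- a) \<le> 1 - a + a\<^sup>2"
proof -
  have "1 + a \<le> exp a" by (rule exp_ge_add_one_self)
  then have "exp (- a) \<le> 1 / (1 + a)"
    using assms by (simp add: exp_minus field_simps)
  also have "\<dots> \<le> 1 - a + a\<^sup>2"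
  proof -
    have "1 \<le> (1 - a + a\<^sup>2) * (1 + a)"
      using assms by (simp add: algebra_simps power2_eq_square)
    then show ?thesis using assms by (simp add: pos_divide_le_eq)
  qed
  finally show ?thesis .
qed

text \<open>Multiplicative weights: each round answers the current weights
  \<open>exp (- h * accumulated value)\<close> with a best response from \<open>S\<close>. The total
  weight \<Phi> shrinks per round by at least the factor \<open>exp (- h * (v - h))\<close>. It
  dominates the weight of every single \<open>x\<close>, so no \<open>x\<close> can have accumulated
  little value, and the uniform mixture of the rounds is the required distribution.\<close>

lemma approximate_minimax:
  fixes A :: "'d \<Rightarrow> 'x \<Rightarrow> real"
  assumes X: "finite X" and S: "S \<noteq> {}"
    and A: "\<And>D x. D \<in> S \<Longrightarrow> x \<in> X \<Longrightarrow> 0 \<le> A D x \<and> A D x \<le> 1"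
    and best: "\<And>w. (\<And>x. 0 \<le> w x) \<Longrightarrow> (\<And>x. x \<notin> X \<Longrightarrow> w x = 0) \<Longrightarrow> sum w X = 1 \<Longrightarrow>
        \<exists>D\<in>S. v \<le> (\<Sum>x\<in>X. w x * A D x)"
    and e: "0 < e"
  shows "\<exists>R. finite (set_pmf R) \<and> set_pmf R \<subseteq> S \<and>
    (\<forall>x\<in>X. v - e \<le> measure_pmf.expectation R (\<lambda>D. A D x))"
proof (cases "X = {}")
  case True
  obtain D where "D \<in> S" using S by blast
  then show ?thesis using True by (intro exI[of _ "return_pmf D"]) auto
next
  case False
  \<comment> \<open>One \<open>h\<close> pays for the quadratic error of each round, the other for
    the initial weight \<open>card X\<close>.\<close>
  define h where "h = e / 2"
  have h: "0 < h" using e by (simp add: h_def)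
  define \<Phi> where "\<Phi> d K = (\<Sum>x\<in>X. exp (- h * (\<Sum>k<K. A (d k) x)))" for d :: "nat \<Rightarrow> 'd" and K
  have run: "\<exists>d. (\<forall>k<K. d k \<in> S) \<and> \<Phi> d K \<le> real (card X) * exp (- h * (v - h) * real K)" for K
  proof (induction K)
    case 0
    then show ?case by (simp add: \<Phi>_def)
  next
    case (Suc K)
    then obtain d where d: "\<forall>k<K. d k \<in> S" "\<Phi> d K \<le> real (card X) * exp (- h * (v - h) * real K)"
      by blast
    define u where "u x = exp (- h * (\<Sum>k<K. A (d k) x))" for x
    have \<Phi>_eq: "\<Phi> d K = sum u X" by (simp add: \<Phi>_def u_def)
    have pos: "0 < \<Phi> d K"
      unfolding \<Phi>_def using X False by (intro sum_pos) auto
    define w where "w x = (if x \<in> X then u x / \<Phi> d K else 0)" for x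
    have "sum w X = 1"
      using pos by (simp add: w_def \<Phi>_eq sum_divide_distrib[symmetric])
    moreover have "0 \<le> w x" for x
      using pos by (simp add: w_def u_def)
    ultimately obtain D where D: "D \<in> S" "v \<le> (\<Sum>x\<in>X. w x * A D x)"
      using best[of w] by (auto simp: w_def)
    have "(\<Sum>x\<in>X. w x * A D x) = (\<Sum>x\<in>X. u x * A D x) / \<Phi> d K"
      by (simp add: w_def sum_divide_distrib)
    with D(2) pos have D': "v * \<Phi> d K \<le> (\<Sum>x\<in>X. u x * A D x)"
      by (simp add: pos_le_divide_eq)
    let ?d = "d(K := D)"
    have "\<Phi> ?d (Suc K) = (\<Sum>x\<in>X. u x * exp (- (h * A D x)))"
      by (simp add: \<Phi>_def u_def exp_add[symmetric] algebra_simps)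
    also have "\<dots> \<le> (\<Sum>x\<in>X. u x * (1 - h * A D x + h\<^sup>2))"
    proof (intro sum_mono mult_left_mono)
      fix x assume x: "x \<in> X"
      have "(h * A D x)\<^sup>2 \<le> h\<^sup>2 * 1"
        using A[OF D(1) x] by (simp add: power_mult_distrib power_le_one mult_left_le)
      moreover have "exp (- (h * A D x)) \<le> 1 - h * A D x + (h * A D x)\<^sup>2"
        using A[OF D(1) x] h by (intro exp_minus_le) simp
      ultimately show "exp (- (h * A D x)) \<le> 1 - h * A D x + h\<^sup>2" by simp
    qed (simp add: u_def)
    also have "\<dots> = (1 + h\<^sup>2) * \<Phi> d K - h * (\<Sum>x\<in>X. u x * A D x)"
      by (simp add: \<Phi>_eq algebra_simps sum.distrib sum_subtractf sum_distrib_left sum_distrib_right)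
    also have "\<dots> \<le> (1 + h\<^sup>2) * \<Phi> d K - h * (v * \<Phi> d K)"
      using D' h by (intro diff_left_mono mult_left_mono) auto
    also have "\<dots> = (1 + - h * (v - h)) * \<Phi> d K"
      by (simp add: algebra_simps power2_eq_square)
    also have "\<dots> \<le> exp (- h * (v - h)) * \<Phi> d K"
      using pos by (intro mult_right_mono exp_ge_add_one_self) auto
    also have "\<dots> \<le> exp (- h * (v - h)) * (real (card X) * exp (- h * (v - h) * real K))"
      using d(2) by (intro mult_left_mono) auto
    also have "\<dots> = real (card X) * exp (- h * (v - h) * real (Suc K))"
      by (simp add: exp_add[symmetric] algebra_simps)
    finally have "\<Phi> ?d (Suc K) \<le> real (card X) * exp (- h * (v - h) * real (Suc K))" .
    moreover have "\<forall>k<Suc K. ?d k \<in> S"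
      using d(1) D(1) by (auto simp: less_Suc_eq)
    ultimately show ?case by blast
  qed
  \<comment> \<open>With this many rounds \<open>ln (card X) / (h * K)\<close> is at most
    \<open>h\<close>.\<close>
  obtain K :: nat where K: "ln (real (card X)) / h\<^sup>2 < real K" using reals_Archimedean2 by blast
  have card: "1 \<le> card X" using X False by (simp add: Suc_le_eq card_gt_0_iff)
  then have "0 \<le> ln (real (card X)) / h\<^sup>2" using h by simp
  with K have K0: "0 < real K" by linarith
  obtain d where d: "\<forall>k<K. d k \<in> S" "\<Phi> d K \<le> real (card X) * exp (- h * (v - h) * real K)"
    using run by blast
  define R where "R = map_pmf d (pmf_of_set {..<K})"
  have ne: "{..<K} \<noteq> {}" using K0 by auto
  have "v - e \<le> measure_pmf.expectation R (\<lambda>D. A D x)" if x: "x \<in> X" for x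
  proof -
    have "exp (- h * (\<Sum>k<K. A (d k) x)) \<le> \<Phi> d K"
      unfolding \<Phi>_def using X x by (intro member_le_sum) auto
    also have "\<dots> \<le> exp (ln (real (card X)) + - h * (v - h) * real K)"
      using d(2) card unfolding exp_add by simp
    finally have "- h * (\<Sum>k<K. A (d k) x) \<le> ln (real (card X)) + - h * (v - h) * real K"
      by simp
    also have "ln (real (card X)) \<le> h * h * real K"
      using K h by (simp add: field_simps power2_eq_square)
    finally have "h * ((v - 2 * h) * real K) \<le> h * (\<Sum>k<K. A (d k) x)"
      by (simp add: algebra_simps)
    then have "(v - e) * real K \<le> (\<Sum>k<K. A (d k) x)"
      using h by (simp add: h_def)
    then show ?thesis
      using K0 ne by (simp add: R_def integral_pmf_of_set pos_le_divide_eq)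
  qed
  then show ?thesis
    using d(1) ne by (intro exI[of _ R]) (auto simp: R_def)
qed

section \<open>Aborting and majority voting\<close>

definition guess :: "('i, bool) dtree pmf" where
  "guess = map_pmf Answer (bernoulli_pmf (1/2))"

lemma finite_guess [simp]: "finite (set_pmf guess)"
  by (simp add: guess_def)

lemma queries_guess: "D \<in> set_pmf guess \<Longrightarrow> queries D = {}"
  by (auto simp: guess_def)

lemma success_guess [simp]: "success guess x y = 1/2"
  unfolding guess_def by (simp only: success_map_Answer pmf_bernoulli_half)

lemma mean_cost_guess [simp]: "mean_cost guess x = 0"
  by (simp add: guess_def)

primrec abort_tree :: "real \<Rightarrow> ('i, bool) dtree \<Rightarrow> ('i, bool) dtree pmf" where
  "abort_tree q (Answer a) = return_pmf (Answer a)"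
| "abort_tree q (Query i l r) = bind_pmf (bernoulli_pmf q)
     (\<lambda>go. if go then query_pmf i (abort_tree q l) (abort_tree q r) else guess)"

lemma finite_abort_tree [simp]: "finite (set_pmf (abort_tree q D))"
  by (induction D) auto

lemma queries_abort_tree: "D' \<in> set_pmf (abort_tree q D) \<Longrightarrow> queries D' \<subseteq> queries D"
  by (induction D arbitrary: D')
     (fastforce simp: set_query_pmf dest: queries_guess split: if_splits)+

text \<open>The run survives all its queries with probability \<open>q ^ dt_cost D x\<close> and
  then answers like \<open>D\<close>; otherwise the answer is a fair coin.\<close>

lemma success_abort_tree:
  assumes "0 \<le> q" "q \<le> 1"
  shows "success (abort_tree q D) x y =
    of_bool (dt_output D x = y) * q ^ dt_cost D x + (1 - q ^ dt_cost D x) / 2"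
proof (induction D)
  case (Query i l r)
  define D where "D = (if x i then r else l)"
  have "success (abort_tree q (Query i l r)) x y = q * success (abort_tree q D) x y + (1 - q) / 2"
    using assms by (simp add: success_bind D_def)
  also have "success (abort_tree q D) x y =
      of_bool (dt_output D x = y) * q ^ dt_cost D x + (1 - q ^ dt_cost D x) / 2"
    using Query by (simp add: D_def)
  also have "q * (of_bool (dt_output D x = y) * q ^ dt_cost D x + (1 - q ^ dt_cost D x) / 2) +
      (1 - q) / 2 = of_bool (dt_output D x = y) * q ^ Suc (dt_cost D x) + (1 - q ^ Suc (dt_cost D x)) / 2"
    by (simp add: field_simps)
  finally show ?case by (simp add: D_def split: if_splits)
qed simp

text \<open>The \<open>k\<close>-th query on the path is made with probability \<open>q ^ k\<close>,
  so the mean cost is a geometric sum; multiplying by \<open>1 - q\<close> avoids a division that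
  fails at \<open>q = 1\<close>.\<close>

lemma mean_cost_abort_tree:
  assumes "0 \<le> q" "q \<le> 1"
  shows "(1 - q) * mean_cost (abort_tree q D) x = q * (1 - q ^ dt_cost D x)"
proof (induction D)
  case (Query i l r)
  have *: "mean_cost (abort_tree q (Query i l r)) x =
      q * (1 + mean_cost (abort_tree q (if x i then r else l)) x)"
    using assms by (simp add: mean_cost_bind mean_cost_query_pmf)
  have "(1 - q) * mean_cost (abort_tree q (Query i l r)) x =
      q * (1 - q) + q * ((1 - q) * mean_cost (abort_tree q (if x i then r else l)) x)"
    unfolding * by (simp only: algebra_simps)
  also have "(1 - q) * mean_cost (abort_tree q (if x i then r else l)) x =
      q * (1 - q ^ dt_cost (if x i then r else l) x)"
    using Query by simp
  finally show ?case
    by (cases "x i") (simp_all add: algebra_simps del: abort_tree.simps)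
qed simp

section \<open>Majority vote over three independent runs\<close>

primrec dt_bind :: "('i, 'a) dtree \<Rightarrow> ('a \<Rightarrow> ('i, 'b) dtree) \<Rightarrow> ('i, 'b) dtree" where
  "dt_bind (Answer a) K = K a"
| "dt_bind (Query i l r) K = Query i (dt_bind l K) (dt_bind r K)"

lemma dt_output_bind [simp]: "dt_output (dt_bind D K) x = dt_output (K (dt_output D x)) x"
  by (induction D) auto

lemma dt_cost_bind [simp]:
  "dt_cost (dt_bind D K) x = dt_cost D x + dt_cost (K (dt_output D x)) x"
  by (induction D) auto

lemma queries_dt_bind: "queries (dt_bind D K) \<subseteq> queries D \<union> (\<Union>a. queries (K a))"
  by (induction D) auto

definition majority_tree ::
  "('i, bool) dtree \<Rightarrow> ('i, bool) dtree \<Rightarrow> ('i, bool) dtree \<Rightarrow> ('i, bool) dtree" where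
  "majority_tree D1 D2 D3 = dt_bind D1 (\<lambda>a. dt_bind D2 (\<lambda>b. dt_bind D3 (\<lambda>c.
     Answer ((a \<and> b) \<or> (b \<and> c) \<or> (c \<and> a)))))"

lemma queries_majority_tree:
  "queries (majority_tree D1 D2 D3) \<subseteq> queries D1 \<union> queries D2 \<union> queries D3"
  unfolding majority_tree_def
  by (rule order_trans[OF queries_dt_bind] Un_least UN_least | auto dest!: subsetD[OF queries_dt_bind])+

definition majority_alg :: "('i, bool) dtree pmf \<Rightarrow> ('i, bool) dtree pmf" where
  "majority_alg R = bind_pmf R (\<lambda>D1. bind_pmf R (\<lambda>D2. map_pmf (majority_tree D1 D2) R))"

lemma set_majority_alg:
  "D \<in> set_pmf (majority_alg R) \<longleftrightarrow>
   (\<exists>D1\<in>set_pmf R. \<exists>D2\<in>set_pmf R. \<exists>D3\<in>set_pmf R. D = majority_tree D1 D2 D3)"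
  by (auto simp: majority_alg_def)

lemma finite_majority_alg [simp]: "finite (set_pmf R) \<Longrightarrow> finite (set_pmf (majority_alg R))"
  by (simp add: majority_alg_def)

lemma expectation_majority_alg:
  fixes h :: "('i, bool) dtree \<Rightarrow> real"
  assumes "finite (set_pmf R)"
  shows "measure_pmf.expectation (majority_alg R) h = measure_pmf.expectation R (\<lambda>D1.
     measure_pmf.expectation R (\<lambda>D2. measure_pmf.expectation R (\<lambda>D3. h (majority_tree D1 D2 D3))))"
  using assms by (simp add: majority_alg_def expectation_bind_pmf_finite)

lemma success_majority_alg:
  assumes R: "finite (set_pmf R)"
  shows "success (majority_alg R) x y = 3 * (success R x y)\<^sup>2 - 2 * success R x y ^ 3"
proof -
  note [simp] = integrable_measure_pmf_finite[OF R]
  let ?a = "\<lambda>D. of_bool (dt_output D x = y) :: real"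
  \<comment> \<open>The majority indicator is multilinear in the three run indicators, so
    independent runs can be integrated one after the other.\<close>
  have maj: "of_bool (dt_output (majority_tree D1 D2 D3) x = y) =
      ?a D1 * ?a D2 + (?a D1 + ?a D2 - 2 * ?a D1 * ?a D2) * ?a D3" for D1 D2 D3 :: "('a, bool) dtree"
    by (auto simp: majority_tree_def)
  show ?thesis
    unfolding success_eq_expectation expectation_majority_alg[OF R] maj
    by (simp add: algebra_simps power2_eq_square power3_eq_cube)
qed

lemma mean_cost_majority_alg:
  assumes R: "finite (set_pmf R)"
  shows "mean_cost (majority_alg R) x = 3 * mean_cost R x"
proof -
  note [simp] = integrable_measure_pmf_finite[OF R]
  show ?thesis
    unfolding mean_cost_def expectation_majority_alg[OF R]
    by (simp add: majority_tree_def)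
qed

lemma majority_polynomial_mono:
  fixes s t :: real
  assumes "0 \<le> s" "s \<le> t" "t \<le> 1"
  shows "3 * s\<^sup>2 - 2 * s ^ 3 \<le> 3 * t\<^sup>2 - 2 * t ^ 3"
proof -
  have "(3 * t\<^sup>2 - 2 * t ^ 3) - (3 * s\<^sup>2 - 2 * s ^ 3) =
      (t - s) * (3 * (t * (1 - t)) + 3 * (s * (1 - s)) + (t - s)\<^sup>2)"
    by (simp add: algebra_simps power2_eq_square power3_eq_cube)
  moreover have "0 \<le> (t - s) * (3 * (t * (1 - t)) + 3 * (s * (1 - s)) + (t - s)\<^sup>2)"
    using assms by (intro mult_nonneg_nonneg add_nonneg_nonneg) auto
  ultimately show ?thesis by linarith
qed

text \<open>Two lower bounds are averaged. Monotonicity from \<open>s0 = \<gamma> - d / 10\<close>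
  gives \<open>\<gamma> + d / 8\<close>; majority never hurts above 1/2, which gives
  \<open>s\<close>, hence \<open>\<gamma> - d / 10 + b\<close>. Their mean is
  \<open>\<gamma> + d / 80 + b / 2\<close>.\<close>

lemma majority_gain:
  fixes \<gamma> d s b :: real
  assumes \<gamma>: "1/2 < \<gamma>" "\<gamma> < 1" and d: "d = min (\<gamma> - 1/2) (1 - \<gamma>)"
    and s: "\<gamma> - d / 10 + b \<le> s" "s \<le> 1" and b: "0 \<le> b"
  shows "\<gamma> + d / 80 + b / 2 \<le> 3 * s\<^sup>2 - 2 * s ^ 3"
proof -
  define s0 where "s0 = \<gamma> - d / 10"
  have d0: "0 < d" "d \<le> \<gamma> - 1/2" "d \<le> 1 - \<gamma>" using \<gamma> d by auto
  have s0: "1/2 \<le> s0" "s0 \<le> s" using d0 b s by (auto simp: s0_def)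
  have id: "3 * z\<^sup>2 - 2 * z ^ 3 = z + z * ((1 - z) * (2 * z - 1))" for z :: real
    by (simp add: algebra_simps power2_eq_square power3_eq_cube)
  have "(1/4) * d \<le> (1 - \<gamma>) * (\<gamma> - 1/2)"
  \<comment> \<open>The two factors sum to 1/2, so the larger is at least 1/4, and the smaller is
    \<open>d\<close>.\<close>
  proof (cases "\<gamma> \<le> 3/4")
    case True
    then show ?thesis using \<gamma> d0 by (intro mult_mono) auto
  next
    case False
    then have "d * (1/4) \<le> (1 - \<gamma>) * (\<gamma> - 1/2)" using \<gamma> d0 by (intro mult_mono) auto
    then show ?thesis by simp
  qed
  \<comment> \<open>Lowering \<gamma> to \<open>s0\<close> only increases \<open>1 - s0\<close>, and
    costs \<open>2 * \<gamma> - 1\<close> at most a tenth, since \<open>d / 5\<close> is at most a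
    tenth of \<open>2 * \<gamma> - 1\<close>.\<close>
  moreover have "(1 - \<gamma>) * (9/5 * (\<gamma> - 1/2)) \<le> (1 - s0) * (2 * s0 - 1)"
    using \<gamma> d0 by (intro mult_mono) (auto simp: s0_def)
  moreover have "(1 - \<gamma>) * (9/5 * (\<gamma> - 1/2)) = 9/5 * ((1 - \<gamma>) * (\<gamma> - 1/2))" by simp
  ultimately have "9/20 * d \<le> (1 - s0) * (2 * s0 - 1)" by linarith
  moreover have "1/2 * ((1 - s0) * (2 * s0 - 1)) \<le> s0 * ((1 - s0) * (2 * s0 - 1))"
    using s0 s by (intro mult_right_mono) auto
  ultimately have g0: "s0 + 9/40 * d \<le> 3 * s0\<^sup>2 - 2 * s0 ^ 3" by (simp add: id)
  also have "\<dots> \<le> 3 * s\<^sup>2 - 2 * s ^ 3"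
    using s0 s by (intro majority_polynomial_mono) auto
  finally have "s0 + 9/40 * d \<le> 3 * s\<^sup>2 - 2 * s ^ 3" .
  moreover have "0 \<le> s * ((1 - s) * (2 * s - 1))"
    using s s0 by (intro mult_nonneg_nonneg) auto
  then have "s \<le> 3 * s\<^sup>2 - 2 * s ^ 3" by (simp add: id)
  ultimately show ?thesis using s d0 by (simp add: s0_def)
qed

text \<open>
  The extra term proportional to \<open>mean_cost R x\<close> makes expensive inputs pay for themselves by a
  higher success probability; with \<open>success R x (f x) \<le> 1\<close> it also bounds the cost.
\<close>

definition boosted ::
  "'i set \<Rightarrow> ('i \<Rightarrow> bool) set \<Rightarrow> (('i \<Rightarrow> bool) \<Rightarrow> bool) \<Rightarrow> real \<Rightarrow> real \<Rightarrow> ('i, bool) dtree pmf \<Rightarrow> bool" where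
  "boosted I X f \<gamma> t R \<longleftrightarrow> finite (set_pmf R) \<and> R \<in> rand_algs I UNIV \<and>
     (\<forall>x\<in>X. \<gamma> + min (\<gamma> - 1/2) (1 - \<gamma>) / 80 +
        min (\<gamma> - 1/2) (1 - \<gamma>) / (240 * t) * mean_cost R x \<le> success R x (f x))"

text \<open>One loss of \<open>d / 20\<close> is in the hypothesis, a second is the minimax error.
  The discount in the value of \<open>R0\<close> becomes the chance of aborting; guesses after an
  abort are right half of the time, and this surplus is proportional to the mean cost. Majority
  voting then recovers the loss of \<open>d / 10\<close>.\<close>

lemma boosting:
  fixes X :: "('i \<Rightarrow> bool) set" and f :: "('i \<Rightarrow> bool) \<Rightarrow> bool"
  assumes X: "finite X" and \<gamma>: "1/2 < \<gamma>" "\<gamma> < 1" and t: "0 < t"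
    and d: "d = min (\<gamma> - 1/2) (1 - \<gamma>)" and q: "q = exp (- (d / (20 * t)))"
    and best: "\<And>w. (\<And>x. 0 \<le> w x) \<Longrightarrow> (\<And>x. x \<notin> X \<Longrightarrow> w x = 0) \<Longrightarrow> sum w X = 1 \<Longrightarrow>
        \<exists>D. queries D \<subseteq> I \<and>
          \<gamma> - d / 20 \<le> (\<Sum>x\<in>X. w x * (of_bool (dt_output D x = f x) * q ^ dt_cost D x))"
  shows "\<exists>R. boosted I X f \<gamma> t R"
proof -
  have d0: "0 < d" using \<gamma> d by auto
  have q01: "0 < q" "q < 1" using d0 t by (auto simp: q)
  define S where "S = {D :: ('i, bool) dtree. queries D \<subseteq> I}"
  define A where "A D x = of_bool (dt_output D x = f x) * q ^ dt_cost D x" for D x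
  have "Answer True \<in> S" by (simp add: S_def)
  then have "S \<noteq> {}" by blast
  moreover have "0 \<le> A D x \<and> A D x \<le> 1" for D x
    using q01 by (auto simp: A_def power_le_one)
  ultimately have "\<exists>R. finite (set_pmf R) \<and> set_pmf R \<subseteq> S \<and>
      (\<forall>x\<in>X. \<gamma> - d / 20 - d / 20 \<le> measure_pmf.expectation R (\<lambda>D. A D x))"
    using X d0 best by (intro approximate_minimax) (auto simp: S_def A_def)
  then obtain R0 where R0: "finite (set_pmf R0)" "set_pmf R0 \<subseteq> S"
    and R0_val: "\<And>x. x \<in> X \<Longrightarrow> \<gamma> - d / 10 \<le> measure_pmf.expectation R0 (\<lambda>D. A D x)"
    by force
  define R1 where "R1 = bind_pmf R0 (abort_tree q)"
  have R1: "finite (set_pmf R1)" using R0 by (simp add: R1_def)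
  have R1q: "queries D \<subseteq> I" if "D \<in> set_pmf R1" for D
    using that R0(2) queries_abort_tree by (fastforce simp: R1_def S_def)
  note [simp] = integrable_measure_pmf_finite[OF R0(1)]
  have val: "\<gamma> - d / 10 + d / (40 * t) * mean_cost R1 x \<le> success R1 x (f x)" if x: "x \<in> X" for x
  proof -
    define p where "p = measure_pmf.expectation R0 (\<lambda>D. q ^ dt_cost D x)"
    define c where "c = d / (20 * t) * mean_cost R1 x"
    define a where "a = measure_pmf.expectation R0 (\<lambda>D. A D x)"
    have R1_val: "success R1 x (f x) = a + (1 - p) / 2"
      using q01 by (simp add: R1_def success_bind success_abort_tree A_def[symmetric] p_def a_def)
    have "(1 - q) * mean_cost R1 x = q * (1 - p)"
    proof -
      have "(1 - q) * mean_cost R1 x =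
          measure_pmf.expectation R0 (\<lambda>D. (1 - q) * mean_cost (abort_tree q D) x)"
        using R0 by (simp add: R1_def mean_cost_bind)
      then show ?thesis using q01 by (simp add: mean_cost_abort_tree p_def)
    qed
    \<comment> \<open>Converts the abort probability \<open>1 - p\<close> into at least
      \<open>d / (20 * t)\<close> per unit of mean cost; half of it is the gain from
      guessing.\<close>
    moreover have "q * (d / (20 * t)) \<le> 1 - q"
    proof -
      have "1 + d / (20 * t) \<le> exp (d / (20 * t))" by (rule exp_ge_add_one_self)
      then have "q * (1 + d / (20 * t)) \<le> q * exp (d / (20 * t))"
        using q01 by (intro mult_left_mono) auto
      also have "\<dots> = 1" by (simp add: q exp_add[symmetric])
      finally show ?thesis by (simp add: algebra_simps)
    qed
    then have "q * (d / (20 * t)) * mean_cost R1 x \<le> (1 - q) * mean_cost R1 x"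
      by (intro mult_right_mono) auto
    ultimately have "q * c \<le> q * (1 - p)" by (simp add: c_def mult.assoc)
    then have "c \<le> 1 - p"
      using q01(1) by (simp only: mult_le_cancel_left_pos)
    moreover have c2: "d / (40 * t) * mean_cost R1 x = c / 2"
      by (simp add: c_def)
    ultimately show ?thesis
      unfolding c2 R1_val using R0_val[OF x, folded a_def] by argo
  qed
  have "boosted I X f \<gamma> t (majority_alg R1)"
    unfolding boosted_def
  proof (intro conjI ballI)
    show "finite (set_pmf (majority_alg R1))" using R1 by simp
    show "majority_alg R1 \<in> rand_algs I UNIV"
      using R1q queries_majority_tree by (fastforce simp: rand_algs_def set_majority_alg)
    fix x assume x: "x \<in> X"
    \<comment> \<open>The vote halves the surplus and triples the cost, whence
      \<open>240 = 40 * 2 * 3\<close>.\<close>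
    have "\<gamma> + d / 80 + d / (40 * t) * mean_cost R1 x / 2 \<le>
        3 * (success R1 x (f x))\<^sup>2 - 2 * success R1 x (f x) ^ 3"
      using \<gamma> d val[OF x] d0 t by (intro majority_gain) auto
    then show "\<gamma> + min (\<gamma> - 1/2) (1 - \<gamma>) / 80 +
        min (\<gamma> - 1/2) (1 - \<gamma>) / (240 * t) * mean_cost (majority_alg R1) x
        \<le> success (majority_alg R1) x (f x)"
      using R1 by (simp add: success_majority_alg mean_cost_majority_alg d[symmetric])
  qed
  then show ?thesis by blast
qed

section \<open>Sequential composition with a query budget\<close>

text \<open>A leaf hands its answer and the unspent budget to \<open>K\<close>. The fallback
  \<open>Z\<close> is entered only when a further query is due at budget 0, so spending exactly
  \<open>b\<close> still counts as finishing.\<close>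

primrec budget_subst ::
  "('i, 'a) dtree \<Rightarrow> nat \<Rightarrow> ('a \<Rightarrow> nat \<Rightarrow> ('i, 'b) dtree pmf) \<Rightarrow> ('i, 'b) dtree pmf \<Rightarrow>
   ('i, 'b) dtree pmf" where
  "budget_subst (Answer a) b K Z = K a b"
| "budget_subst (Query i l r) b K Z =
     (case b of 0 \<Rightarrow> Z | Suc b' \<Rightarrow> query_pmf i (budget_subst l b' K Z) (budget_subst r b' K Z))"

lemma success_budget_subst:
  "success (budget_subst D b K Z) x y =
    (if dt_cost D x \<le> b then success (K (dt_output D x) (b - dt_cost D x)) x y else success Z x y)"
  by (induction D arbitrary: b) (auto split: nat.split)

text \<open>An induction rule for budget invariants of the sampled trees. \<open>D0\<close> stays
  fixed while the induction descends into \<open>D\<close>, so the \<open>Query\<close> premise need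
  not mention the current subtree.\<close>

lemma set_budget_subst:
  assumes "D' \<in> set_pmf (budget_subst D b K Z)"
    and "\<And>D b'. D \<in> set_pmf Z \<Longrightarrow> P b' D"
    and "\<And>a b' D. D \<in> set_pmf (K a b') \<Longrightarrow> P b' D"
    and "\<And>b' i l r. i \<in> queries D0 \<Longrightarrow> P b' l \<Longrightarrow> P b' r \<Longrightarrow> P (Suc b') (Query i l r)"
    and "queries D \<subseteq> queries D0"
  shows "P b D'"
  using assms(1,5)
proof (induction D arbitrary: b D')
  case (Query i l r)
  show ?case
  proof (cases b)
    case 0
    then show ?thesis using Query.prems assms(2) by simp
  next
    case (Suc b')
    with Query.prems obtain l' r' where "l' \<in> set_pmf (budget_subst l b' K Z)"
      "r' \<in> set_pmf (budget_subst r b' K Z)" "D' = Query i l' r'"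
      by (auto simp: set_query_pmf)
    then show ?thesis
      using Query.IH(1)[of l' b'] Query.IH(2)[of r' b'] Query.prems(2) assms(4) Suc by simp
  qed
qed (simp add: assms(3))

text \<open>Blocks are solved from the last down to block 0, with a fresh sample of \<open>R\<close>
  for each. When the budget runs out, the current and all lower blocks are guessed uniformly, while
  answers for finished blocks are kept by the outer updates. The base label is the only bit string
  over the empty index set.\<close>

primrec sequential :: "('i, bool) dtree pmf \<Rightarrow> nat \<Rightarrow> nat \<Rightarrow> (nat \<times> 'i, nat \<Rightarrow> bool) dtree pmf" where
  "sequential R 0 b = return_pmf (Answer (\<lambda>_. undefined))"
| "sequential R (Suc j) b = bind_pmf R (\<lambda>D. budget_subst (map_dtree (Pair j) id D) b
     (\<lambda>a b'. map_pmf (map_dtree id (\<lambda>y. y(j := a))) (sequential R j b'))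
     (map_pmf Answer (pmf_of_set ({..<Suc j} \<rightarrow>\<^sub>E UNIV))))"

lemma dt_output_map_dtree: "dt_output (map_dtree g h D) x = h (dt_output D (\<lambda>i. x (g i)))"
  by (induction D) auto

lemma dt_cost_map_dtree: "dt_cost (map_dtree g h D) x = dt_cost D (\<lambda>i. x (g i))"
  by (induction D) auto

lemma finite_PiE_bool: "finite I \<Longrightarrow> finite (I \<rightarrow>\<^sub>E (UNIV :: bool set))"
  by (intro finite_PiE) auto

lemma sequential_valid:
  fixes m :: nat
  assumes "R \<in> rand_algs {..<m} UNIV" "D \<in> set_pmf (sequential R j b)"
  shows "queries D \<subseteq> {..<j} \<times> {..<m} \<and> labels D \<subseteq> {..<j} \<rightarrow>\<^sub>E UNIV \<and> (\<forall>z. dt_cost D z \<le> b)"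
  using assms(2)
proof (induction j arbitrary: b D)
  case (Suc j)
  let ?P = "\<lambda>b D. queries D \<subseteq> {..<Suc j} \<times> {..<m} \<and>
    labels D \<subseteq> {..<Suc j} \<rightarrow>\<^sub>E (UNIV :: bool set) \<and> (\<forall>z. dt_cost D z \<le> b)"
  from Suc.prems obtain D0 where D0: "D0 \<in> set_pmf R"
    and D: "D \<in> set_pmf (budget_subst (map_dtree (Pair j) id D0) b
     (\<lambda>a b'. map_pmf (map_dtree id (\<lambda>y. y(j := a))) (sequential R j b'))
     (map_pmf Answer (pmf_of_set ({..<Suc j} \<rightarrow>\<^sub>E UNIV))))"
    by auto
  have "queries D0 \<subseteq> {..<m}" using D0 assms(1) by (auto simp: rand_algs_def)
  then have q: "queries (map_dtree (Pair j) id D0) \<subseteq> {..<Suc j} \<times> {..<m}"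
    unfolding dtree.set_map by blast
  from D show ?case
  proof (rule set_budget_subst[where P = ?P and ?D0.0 = "map_dtree (Pair j) id D0"])
    fix D :: "(nat \<times> nat, nat \<Rightarrow> bool) dtree" and b'
    assume "D \<in> set_pmf (map_pmf Answer (pmf_of_set ({..<Suc j} \<rightarrow>\<^sub>E UNIV)))"
    then obtain y where "D = Answer y" "y \<in> {..<Suc j} \<rightarrow>\<^sub>E UNIV"
      using set_pmf_of_set[of "{..<Suc j} \<rightarrow>\<^sub>E (UNIV :: bool set)"]
      by (auto simp: PiE_eq_empty_iff finite_PiE_bool simp del: lessThan_Suc)
    then show "?P b' D" by simp
  next
    fix a b' and D :: "(nat \<times> nat, nat \<Rightarrow> bool) dtree"
    assume "D \<in> set_pmf (map_pmf (map_dtree id (\<lambda>y. y(j := a))) (sequential R j b'))"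
    then obtain D1 where D1: "D1 \<in> set_pmf (sequential R j b')" "D = map_dtree id (\<lambda>y. y(j := a)) D1"
      by auto
    have "y(j := a) \<in> {..<Suc j} \<rightarrow>\<^sub>E UNIV" if "y \<in> {..<j} \<rightarrow>\<^sub>E UNIV" for y
      using that by (simp add: PiE_iff extensional_def)
    moreover note IH = Suc.IH[OF D1(1)]
    ultimately have "labels D \<subseteq> {..<Suc j} \<rightarrow>\<^sub>E UNIV"
      by (auto simp only: D1(2) dtree.set_map)
    moreover have "queries D \<subseteq> {..<Suc j} \<times> {..<m}"
      using IH by (auto simp: D1(2) dtree.set_map less_Suc_eq)
    moreover have "\<forall>z. dt_cost D z \<le> b'"
      using IH by (simp add: D1(2) dt_cost_map_dtree)
    ultimately show "?P b' D" by blast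
  next
    fix b' i and l r :: "(nat \<times> nat, nat \<Rightarrow> bool) dtree"
    assume "i \<in> queries (map_dtree (Pair j) id D0)" "?P b' l" "?P b' r"
    moreover from this(1) q have "i \<in> {..<Suc j} \<times> {..<m}" by blast
    ultimately show "?P (Suc b') (Query i l r)" by simp
  qed simp
qed simp

text \<open>One step of the recursion over blocks. Allowing any pointwise minorant \<open>g\<close>
  lets a potential argument treat each sampled tree separately and integrate afterwards;
  \<open>(1/2) ^ Suc j\<close> is the exact success of the final guess.\<close>

lemma success_sequential_Suc:
  assumes R: "R \<in> rand_algs {..<m} UNIV" and fin: "finite (set_pmf R)"
    and step: "\<And>D. D \<in> set_pmf R \<Longrightarrow> g D \<le>
      (if dt_cost D (block m z j) \<le> b
       then of_bool (dt_output D (block m z j) = f (block m z j)) *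
         success (sequential R j (b - dt_cost D (block m z j))) z (direct_product m j f z)
       else (1/2) ^ Suc j)"
  shows "measure_pmf.expectation R g \<le> success (sequential R (Suc j) b) z (direct_product m (Suc j) f z)"
proof -
  let ?x = "block m z j"
  let ?Z = "map_pmf Answer (pmf_of_set ({..<Suc j} \<rightarrow>\<^sub>E UNIV)) :: (nat \<times> nat, nat \<Rightarrow> bool) dtree pmf"
  let ?K = "\<lambda>a b'. map_pmf (map_dtree id (\<lambda>y. y(j := a))) (sequential R j b')"
  have dp: "direct_product m (Suc j) f z = (direct_product m j f z)(j := f ?x)"
    by (auto simp: direct_product_def fun_eq_iff restrict_def less_Suc_eq)
  have "g D \<le> success (budget_subst (map_dtree (Pair j) id D) b ?K ?Z) z (direct_product m (Suc j) f z)"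
    if D: "D \<in> set_pmf R" for D
  proof -
    \<comment> \<open>\<open>block\<close> is undefined from index \<open>m\<close> on, so agreement
      relies on \<open>D\<close> querying only below \<open>m\<close>.\<close>
    have eq: "z (j, i) = ?x i" if "i \<in> queries D" for i
      using that D R by (auto simp: rand_algs_def block_def)
    have out: "dt_output D (\<lambda>i. z (j, i)) = dt_output D ?x" "dt_cost D (\<lambda>i. z (j, i)) = dt_cost D ?x"
      by (intro dt_output_cong dt_cost_cong eq; assumption)+
    have Z: "success ?Z z (direct_product m (Suc j) f z) = (1/2) ^ Suc j"
    proof -
      have "direct_product m (Suc j) f z \<in> {..<Suc j} \<rightarrow>\<^sub>E UNIV"
        by (simp add: direct_product_def)
      moreover have "card ({..<Suc j} \<rightarrow>\<^sub>E (UNIV :: bool set)) = 2 ^ Suc j"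
        by (subst card_PiE) (simp_all add: card_UNIV_bool)
      ultimately show ?thesis
        by (simp add: PiE_eq_empty_iff finite_PiE_bool power_one_over)
    qed
    have K: "of_bool (dt_output D ?x = f ?x) * success (sequential R j b') z (direct_product m j f z)
        \<le> success (?K (dt_output D ?x) b') z (direct_product m (Suc j) f z)" for b'
      by (auto simp: dp success_eq_prob dt_output_map_dtree vimage_def intro!: measure_pmf.finite_measure_mono)
    show ?thesis
    proof (cases "dt_cost D ?x \<le> b")
      case True
      then have "g D \<le> of_bool (dt_output D ?x = f ?x) *
          success (sequential R j (b - dt_cost D ?x)) z (direct_product m j f z)"
        using step[OF D] by simp
      also note K
      finally show ?thesis
        using True by (simp only: success_budget_subst dt_cost_map_dtree dt_output_map_dtree out if_True id_apply)
    next
      case False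
      then show ?thesis
        using step[OF D] Z by (simp only: success_budget_subst dt_cost_map_dtree out if_False)
    qed
  qed
  then show ?thesis
    unfolding sequential.simps success_bind
    by (intro integral_mono_AE) (auto simp: integrable_measure_pmf_finite[OF fin] AE_measure_pmf_iff)
qed

lemma direct_product_0 [simp]: "direct_product m 0 f z = (\<lambda>_. undefined)"
  by (simp add: direct_product_def fun_eq_iff)

text \<open>
  In the next two lemmas \<open>e\<close> is the fractional part of a real-valued budget: costs are integers, so
  a real budget \<open>b + e\<close> is exceeded exactly when \<open>b\<close> is. The linear potential serves \<open>\<gamma>\<close> close
  to \<open>1\<close>, where every input is cheap on average. For \<open>\<gamma>\<close> close to \<open>1/2\<close> an input may be expensive,
  but then its success surplus outweighs the guesses forced on the remaining blocks; the exponential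
  potential, capped at \<open>1\<close>, accounts for that trade.
\<close>

lemma success_sequential_linear:
  assumes R: "R \<in> rand_algs {..<m} UNIV" "finite (set_pmf R)"
    and \<rho>: "0 < \<rho>" and r: "0 \<le> r" and B: "0 < B" and e: "0 \<le> e" "e < 1"
    and val: "\<And>x. x \<in> X \<Longrightarrow> \<rho> \<le> success R x (f x) \<and> mean_cost R x \<le> \<rho> * r"
    and "\<And>k. k < j \<Longrightarrow> block m z k \<in> X" "real b + e \<le> B"
  shows "\<rho> ^ j * ((real b + e - r * real j) / B) \<le> success (sequential R j b) z (direct_product m j f z)"
  using assms(9,10)
proof (induction j arbitrary: b)
  case 0
  then show ?case using B by (simp add: pos_divide_le_eq)
next
  case (Suc j)
  let ?x = "block m z j"
  define u where "u = real b + e - r * real j"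
  have x: "?x \<in> X" using Suc.prems by simp
  show ?case
  \<comment> \<open>An exhausted potential makes the claimed bound nonpositive.\<close>
  proof (cases "u \<le> 0")
    case True
    then have "real b + e - r * real (Suc j) \<le> 0" using r by (simp add: u_def algebra_simps)
    then have "\<rho> ^ Suc j * ((real b + e - r * real (Suc j)) / B) \<le> 0"
      using \<rho> B by (intro mult_nonneg_nonpos divide_nonpos_pos) auto
    then show ?thesis by (rule order_trans) simp
  next
    case False
    \<comment> \<open>The cost is charged even for wrong answers, which makes \<open>g\<close>
      linear in the success indicator and the cost.\<close>
    define g where "g D = \<rho> ^ j / B * (of_bool (dt_output D ?x = f ?x) * u - real (dt_cost D ?x))"
      for D
    have c0: "0 < \<rho> ^ j / B" using \<rho> B by simp
    have "g D \<le> (if dt_cost D ?x \<le> b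
       then of_bool (dt_output D ?x = f ?x) *
         success (sequential R j (b - dt_cost D ?x)) z (direct_product m j f z)
       else (1/2) ^ Suc j)" for D
    proof (cases "dt_cost D ?x \<le> b")
      case True
      have IH: "\<rho> ^ j * ((real (b - dt_cost D ?x) + e - r * real j) / B)
          \<le> success (sequential R j (b - dt_cost D ?x)) z (direct_product m j f z)"
        using Suc.prems True by (intro Suc.IH) auto
      have eq: "\<rho> ^ j * ((real (b - dt_cost D ?x) + e - r * real j) / B) =
          \<rho> ^ j / B * (u - real (dt_cost D ?x))"
        using True by (simp add: u_def of_nat_diff algebra_simps add_divide_distrib diff_divide_distrib)
      note IH[unfolded eq]
      moreover have "\<rho> ^ j / B * - real (dt_cost D ?x) \<le> 0"
        using c0 by (intro mult_nonneg_nonpos) auto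
      ultimately show ?thesis
        using True unfolding g_def by (cases "dt_output D ?x = f ?x") simp_all
    next
      case over: False
      have "of_bool (dt_output D ?x = f ?x) * u \<le> u" using False by simp
      moreover have "u \<le> real b + e" using r by (simp add: u_def)
      \<comment> \<open>An overrun costs a whole query more than \<open>b\<close>, hence more than
        \<open>b + e\<close>, so \<open>g\<close> is negative there and the guess may be valued at
        0.\<close>
      moreover have "real b + 1 \<le> real (dt_cost D ?x)" using over by linarith
      ultimately have "of_bool (dt_output D ?x = f ?x) * u - real (dt_cost D ?x) \<le> 0"
        using e by linarith
      then have "g D \<le> 0" using c0 unfolding g_def by (intro mult_nonneg_nonpos) auto
      also have "0 \<le> (1/2 :: real) ^ Suc j" by simp
      finally show ?thesis using over by simp
    qed
    then have "measure_pmf.expectation R g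
        \<le> success (sequential R (Suc j) b) z (direct_product m (Suc j) f z)"
      by (rule success_sequential_Suc[OF R])
    moreover have "measure_pmf.expectation R g = \<rho> ^ j / B * (success R ?x (f ?x) * u - mean_cost R ?x)"
      unfolding g_def success_eq_expectation mean_cost_def
      by (simp add: integrable_measure_pmf_finite[OF R(2)] del: of_bool_eq_iff)
    moreover have "\<rho> ^ j / B * (\<rho> * u - \<rho> * r) \<le> \<rho> ^ j / B * (success R ?x (f ?x) * u - mean_cost R ?x)"
      using c0 val[OF x] False by (intro mult_left_mono diff_mono mult_right_mono) auto
    moreover have "\<rho> ^ Suc j * ((real b + e - r * real (Suc j)) / B) = \<rho> ^ j / B * (\<rho> * u - \<rho> * r)"
      by (simp add: u_def algebra_simps add_divide_distrib diff_divide_distrib)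
    ultimately show ?thesis by linarith
  qed
qed

lemma success_sequential_exponential:
  assumes R: "R \<in> rand_algs {..<m} UNIV" "finite (set_pmf R)"
    and \<rho>: "1/2 \<le> \<rho>" and \<theta>: "0 \<le> \<theta>" and e: "0 \<le> e" "e < 1"
    and val: "\<And>x. x \<in> X \<Longrightarrow> \<rho> + \<theta> * mean_cost R x \<le> success R x (f x)"
    and "j \<le> n" "\<And>k. k < j \<Longrightarrow> block m z k \<in> X"
  shows "\<rho> ^ j * min (exp (\<theta> * (real b + e)) / (2 * (2 * \<rho>) ^ n)) 1
    \<le> success (sequential R j b) z (direct_product m j f z)"
  using assms(8,9)
proof (induction j arbitrary: b)
  case 0
  then show ?case by simp
next
  case (Suc j)
  let ?x = "block m z j"
  define h where "h b = min (exp (\<theta> * (real b + e)) / (2 * (2 * \<rho>) ^ n)) 1" for b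
  have x: "?x \<in> X" using Suc.prems by simp
  have h0: "0 \<le> h b" for b using \<rho> by (simp add: h_def)
  have \<rho>j: "0 < \<rho> ^ j" using \<rho> by simp
  \<comment> \<open>The linearized form of the discount \<open>exp (- \<theta> * cost)\<close>, so
    that the expectation yields exactly the surplus hypothesis \<open>val\<close>.\<close>
  define g where "g D = \<rho> ^ j * (h b * (of_bool (dt_output D ?x = f ?x) - \<theta> * real (dt_cost D ?x)))"
    for D
  have lin: "a - \<theta> * real c \<le> a * exp (- (\<theta> * real c))" if "a = 0 \<or> a = 1" for a :: real and c
    using that exp_ge_add_one_self[of "- (\<theta> * real c)"] \<theta> by auto
  have "g D \<le> (if dt_cost D ?x \<le> b
     then of_bool (dt_output D ?x = f ?x) *
       success (sequential R j (b - dt_cost D ?x)) z (direct_product m j f z)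
     else (1/2) ^ Suc j)" for D
  proof -
    define a :: real where "a = of_bool (dt_output D ?x = f ?x)"
    define c where "c = dt_cost D ?x"
    have a: "a = 0 \<or> a = 1" by (cases "dt_output D ?x = f ?x") (simp_all add: a_def)
    have "g D = \<rho> ^ j * (h b * (a - \<theta> * real c))"
      by (simp add: g_def a_def c_def)
    also have "\<dots> \<le> \<rho> ^ j * (h b * (a * exp (- (\<theta> * real c))))"
      using \<rho>j h0 lin[OF a] by (intro mult_left_mono) auto
    also have "\<dots> = a * (\<rho> ^ j * (h b * exp (- (\<theta> * real c))))" by simp
    finally have g: "g D \<le> a * (\<rho> ^ j * (h b * exp (- (\<theta> * real c))))" .
    have he: "h b * exp (- (\<theta> * real c)) \<le>
        min (exp (\<theta> * (real b + e - real c)) / (2 * (2 * \<rho>) ^ n)) 1"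
    proof -
      have "h b * exp (- (\<theta> * real c)) \<le>
          exp (\<theta> * (real b + e)) / (2 * (2 * \<rho>) ^ n) * exp (- (\<theta> * real c))"
        by (intro mult_right_mono) (auto simp: h_def)
      also have "\<dots> = exp (\<theta> * (real b + e - real c)) / (2 * (2 * \<rho>) ^ n)"
        by (simp add: right_diff_distrib exp_diff exp_minus divide_simps)
      finally have "h b * exp (- (\<theta> * real c)) \<le> exp (\<theta> * (real b + e - real c)) / (2 * (2 * \<rho>) ^ n)" .
      moreover have "h b * exp (- (\<theta> * real c)) \<le> 1 * 1"
        using \<theta> by (intro mult_mono) (auto simp: h_def)
      ultimately show ?thesis by simp
    qed
    show ?thesis
    proof (cases "c \<le> b")
      case True
      note g
      also have "a * (\<rho> ^ j * (h b * exp (- (\<theta> * real c)))) \<le> a * (\<rho> ^ j * h (b - c))"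
        using he True \<rho>j a by (intro mult_left_mono) (auto simp: h_def of_nat_diff algebra_simps)
      also have "\<dots> \<le> a * success (sequential R j (b - c)) z (direct_product m j f z)"
        using Suc.IH[of "b - c"] Suc.prems a by (intro mult_left_mono) (auto simp: h_def)
      finally show ?thesis using True by (simp add: a_def c_def)
    next
      case False
      have "\<theta> * (real b + e - real c) \<le> 0"
        using \<theta> e False by (intro mult_nonneg_nonpos) auto
      then have "exp (\<theta> * (real b + e - real c)) / (2 * (2 * \<rho>) ^ n) \<le> 1 / (2 * (2 * \<rho>) ^ n)"
        using \<rho> by (intro divide_right_mono) auto
      with he have he': "h b * exp (- (\<theta> * real c)) \<le> 1 / (2 * (2 * \<rho>) ^ n)" by linarith
      note g
      also have "a * (\<rho> ^ j * (h b * exp (- (\<theta> * real c)))) \<le> 1 * (\<rho> ^ j * (1 / (2 * (2 * \<rho>) ^ n)))"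
        using he' \<rho>j a h0 \<rho> by (intro mult_mono) auto
      \<comment> \<open>The normalization \<open>2 * (2 * \<rho>) ^ n\<close> is made for this:
        after an overrun the potential is worth no more than the guess.\<close>
      also have "\<dots> \<le> \<rho> ^ j * (1 / (2 * (2 * \<rho>) ^ j))"
        unfolding mult_1 using \<rho> Suc.prems(1) \<rho>j
        by (intro mult_left_mono divide_left_mono power_increasing mult_pos_pos) auto
      also have "\<dots> = (1/2) ^ Suc j"
        using \<rho> by (simp add: power_mult_distrib power_one_over field_simps)
      finally show ?thesis using False by (simp add: c_def)
    qed
  qed
  then have "measure_pmf.expectation R g
      \<le> success (sequential R (Suc j) b) z (direct_product m (Suc j) f z)"
    by (rule success_sequential_Suc[OF R])
  moreover have "measure_pmf.expectation R g = \<rho> ^ j * (h b * (success R ?x (f ?x) - \<theta> * mean_cost R ?x))"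
    unfolding g_def success_eq_expectation mean_cost_def
    by (simp add: integrable_measure_pmf_finite[OF R(2)] del: of_bool_eq_iff)
  moreover have "\<rho> ^ j * (h b * \<rho>) \<le> \<rho> ^ j * (h b * (success R ?x (f ?x) - \<theta> * mean_cost R ?x))"
    using \<rho>j h0 val[OF x] by (intro mult_left_mono) auto
  ultimately have "\<rho> ^ Suc j * h b \<le> success (sequential R (Suc j) b) z (direct_product m (Suc j) f z)"
    by (simp add: mult_ac)
  then show ?case by (simp add: h_def)
qed

section \<open>From a boosted algorithm to an upper bound for the direct product\<close>

lemma R_power_le_sequential:
  assumes R: "R \<in> rand_algs {..<m} UNIV"
    and suc: "\<And>z. z \<in> power_dom m n X \<Longrightarrow>
      p \<le> success (sequential R n b) z (direct_product m n f z)"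
  shows "R_power m n X f p \<le> of_nat b"
proof -
  have "sequential R n b \<in> rand_algs ({..<n} \<times> {..<m}) ({..<n} \<rightarrow>\<^sub>E UNIV)"
    using sequential_valid[OF R] unfolding rand_algs_def by blast
  then have "R_power m n X f p \<le> (SUP z\<in>power_dom m n X. SUP D\<in>set_pmf (sequential R n b). of_nat (dt_cost D z))"
    unfolding R_power_def worst_case_R_def using suc
    by (intro INF_lower) (auto simp: success_eq_prob)
  also have "\<dots> \<le> of_nat b"
    using sequential_valid[OF R] by (intro SUP_least) (auto simp del: of_nat_le_iff intro!: of_nat_mono)
  finally show ?thesis .
qed

text \<open>The budget is \<open>960 * t\<close> per block. If \<open>d = 1 - \<gamma>\<close>, the
  surplus cannot exceed \<open>d\<close>, which caps the mean cost at \<open>240 * t\<close>; the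
  linear potential keeps half its value, and \<open>\<rho> ^ n\<close> makes up for that half. If
  \<open>d = \<gamma> - 1/2\<close>, the exponential potential starts at its cap 1.\<close>

lemma R_power_le_boosted:
  assumes b: "boosted {..<m} X f \<gamma> t R" and \<gamma>: "1/2 < \<gamma>" "\<gamma> < 1" and t: "0 < t"
    and d: "d = min (\<gamma> - 1/2) (1 - \<gamma>)" and n: "80 \<le> real n * d"
  shows "R_power m n X f (\<gamma> ^ n) \<le> ennreal (960 * t * real n)"
proof -
  define B where "B = 960 * t * real n"
  \<comment> \<open>Trees need an integral budget; \<open>e\<close> restores the exact value
    \<open>B\<close> in the potentials.\<close>
  define b where "b = nat \<lfloor>B\<rfloor>"
  define e where "e = B - real b"
  define \<rho> where "\<rho> = \<gamma> + d / 80"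
  have d0: "0 < d" "d \<le> 1" using \<gamma> d by auto
  have n0: "0 < real n" using n d0 by (cases n) auto
  have B0: "0 < B" using n0 t by (simp add: B_def)
  have b_eq: "real b = of_int \<lfloor>B\<rfloor>" using B0 by (simp add: b_def)
  have e: "0 \<le> e" "e < 1" unfolding e_def b_eq by linarith+
  have be: "real b + e = B" by (simp add: e_def)
  from b have R: "R \<in> rand_algs {..<m} UNIV" "finite (set_pmf R)"
    and val: "\<And>x. x \<in> X \<Longrightarrow> \<rho> + d / (240 * t) * mean_cost R x \<le> success R x (f x)"
    by (auto simp: boosted_def \<rho>_def d)
  have \<rho>: "1/2 \<le> \<rho>" "\<gamma> \<le> \<rho>" using \<gamma> d0 by (auto simp: \<rho>_def)
  have "\<gamma> ^ n \<le> success (sequential R n b) z (direct_product m n f z)" if z: "z \<in> power_dom m n X" for z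
  proof (cases "1 - \<gamma> \<le> \<gamma> - 1/2")
    case True
    then have d': "d = 1 - \<gamma>" by (simp add: d)
    have "\<rho> \<le> success R x (f x) \<and> mean_cost R x \<le> \<rho> * (480 * t)" if x: "x \<in> X" for x
    proof -
      define c where "c = d / (240 * t) * mean_cost R x"
      have nn: "0 \<le> c" using d0 t by (simp add: c_def)
      have val': "\<rho> + c \<le> success R x (f x)" using val[OF x] by (simp add: c_def)
      also have "\<dots> \<le> 1" by simp
      finally have "c \<le> d" using d0 d' unfolding \<rho>_def by linarith
      then have "mean_cost R x \<le> 240 * t" using d0 t by (simp add: c_def field_simps)
      also have "\<dots> \<le> \<rho> * (480 * t)" using \<rho> t by simp
      finally show ?thesis using val' nn by linarith
    qed
    then have "\<rho> ^ n * ((real b + e - 480 * t * real n) / B) \<le>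
        success (sequential R n b) z (direct_product m n f z)"
      using R \<rho> t B0 e z by (intro success_sequential_linear[where X = X]) (auto simp: be power_dom_def)
    moreover have "(real b + e - 480 * t * real n) / B = 1/2"
      unfolding be using t n0 by (simp add: B_def field_simps)
    \<comment> \<open>The surplus \<open>d / 80\<close> of \<rho> over \<gamma>, compounded over at
      least \<open>80 / d\<close> blocks, doubles the bound.\<close>
    moreover have "2 * \<gamma> ^ n \<le> \<rho> ^ n"
    proof -
      have "1 + real n * (d / 80) \<le> (1 + d / 80) ^ n"
        using d0 by (intro Bernoulli_inequality) auto
      then have "2 \<le> (1 + d / 80) ^ n" using n by simp
      then have "2 * \<gamma> ^ n \<le> (1 + d / 80) ^ n * \<gamma> ^ n" using \<gamma> by (intro mult_right_mono) auto
      also have "\<dots> = ((1 + d / 80) * \<gamma>) ^ n" by (simp add: power_mult_distrib)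
      also have "\<dots> \<le> \<rho> ^ n"
      proof (intro power_mono)
        have "d / 80 * \<gamma> \<le> d / 80 * 1" using \<gamma> d0 by (intro mult_left_mono) auto
        then show "(1 + d / 80) * \<gamma> \<le> \<rho>" by (simp add: \<rho>_def algebra_simps)
      qed (use \<gamma> d0 in auto)
      finally show ?thesis .
    qed
    ultimately show ?thesis by simp
  next
    case False
    then have d': "d = \<gamma> - 1/2" by (simp add: d)
    define \<theta> where "\<theta> = d / (240 * t)"
    have "\<rho> ^ n * min (exp (\<theta> * (real b + e)) / (2 * (2 * \<rho>) ^ n)) 1
        \<le> success (sequential R n b) z (direct_product m n f z)"
      using R \<rho> t d0 e z val
      by (intro success_sequential_exponential[where X = X]) (auto simp: power_dom_def \<theta>_def)
    \<comment> \<open>The exponent is \<open>4 * n * d\<close>: three parts cover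
      \<open>2 * \<rho> \<le> 1 + 3 * d\<close>, the fourth covers the factor 2.\<close>
    moreover have "2 * (2 * \<rho>) ^ n \<le> exp (\<theta> * (real b + e))"
    proof -
      have "2 * \<rho> \<le> 1 + 3 * d" using d0 by (simp add: \<rho>_def d')
      also have "\<dots> \<le> exp (3 * d)" by (rule exp_ge_add_one_self)
      finally have "(2 * \<rho>) ^ n \<le> exp (3 * d) ^ n" using \<rho> by (intro power_mono) auto
      moreover have "2 \<le> exp (real n * d)"
        using exp_ge_add_one_self[of "real n * d"] n by linarith
      ultimately have "2 * (2 * \<rho>) ^ n \<le> exp (real n * d) * exp (3 * d) ^ n"
        using \<rho> by (intro mult_mono) auto
      also have "\<dots> = exp (\<theta> * (real b + e))"
      proof -
        have "\<theta> * (real b + e) = real n * d + real n * (3 * d)"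
          unfolding be using t by (simp add: \<theta>_def B_def)
        then show ?thesis by (simp only: exp_add exp_of_nat_mult)
      qed
      finally show ?thesis .
    qed
    then have "min (exp (\<theta> * (real b + e)) / (2 * (2 * \<rho>) ^ n)) 1 = 1"
      using \<rho> by (simp add: min_def pos_divide_le_eq pos_le_divide_eq)
    moreover have "\<gamma> ^ n \<le> \<rho> ^ n" using \<gamma> \<rho> by (intro power_mono) auto
    ultimately show ?thesis by simp
  qed
  then have "R_power m n X f (\<gamma> ^ n) \<le> of_nat b"
    using R by (intro R_power_le_sequential) auto
  also have "\<dots> = ennreal (real b)" by (simp add: ennreal_of_nat_eq_real_of_nat)
  also have "\<dots> \<le> ennreal B" using be e by (intro ennreal_leI) linarith
  finally show ?thesis by (simp add: B_def)
qed

section \<open>The distributional complexity of one instance\<close>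

lemma prob_pair_pmf_eq_success:
  "measure_pmf.prob (pair_pmf \<mu> R) {(x, D). dt_output D x = g x} =
    measure_pmf.expectation \<mu> (\<lambda>x. success R x (g x))"
proof -
  have "measure_pmf.prob (pair_pmf \<mu> R) {(x, D). dt_output D x = g x} =
      pmf (map_pmf (\<lambda>(x, D). dt_output D x = g x) (pair_pmf \<mu> R)) True"
    by (simp add: pmf_map vimage_def case_prod_beta')
  also have "map_pmf (\<lambda>(x, D). dt_output D x = g x) (pair_pmf \<mu> R) =
      bind_pmf \<mu> (\<lambda>x. map_pmf (\<lambda>D. dt_output D x = g x) R)"
    by (simp add: pair_pmf_def map_bind_pmf map_pmf_def bind_assoc_pmf bind_return_pmf)
  finally show ?thesis
    by (simp add: pmf_bind pmf_map vimage_def success_eq_prob)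
qed

lemma nn_integral_pair_pmf_eq_mean_cost:
  assumes "finite (set_pmf \<mu>)" "finite (set_pmf R)"
  shows "(\<integral>\<^sup>+ (x, D). of_nat (dt_cost D x) \<partial>measure_pmf (pair_pmf \<mu> R)) =
    ennreal (measure_pmf.expectation \<mu> (mean_cost R))"
proof -
  have "(\<integral>\<^sup>+ (x, D). of_nat (dt_cost D x) \<partial>measure_pmf (pair_pmf \<mu> R)) =
      (\<integral>\<^sup>+ x. \<integral>\<^sup>+ D. ennreal (real (dt_cost D x)) \<partial>measure_pmf R \<partial>measure_pmf \<mu>)"
    by (simp add: nn_integral_pair_pmf' ennreal_of_nat_eq_real_of_nat)
  also have "\<dots> = (\<integral>\<^sup>+ x. ennreal (mean_cost R x) \<partial>measure_pmf \<mu>)"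
    unfolding mean_cost_def
    by (intro nn_integral_cong nn_integral_eq_integral integrable_measure_pmf_finite assms) simp
  also have "\<dots> = ennreal (measure_pmf.expectation \<mu> (mean_cost R))"
    by (intro nn_integral_eq_integral integrable_measure_pmf_finite assms) simp
  finally show ?thesis .
qed

text \<open>Only averages over \<mu> matter here, so surplus success can be traded for cost. For
  \<gamma> near 1 the surplus is bounded by \<open>d\<close> and so is the average cost by
  \<open>240 * t\<close>; for \<gamma> near 1/2 the algorithm is replaced by a free guess with a
  suitable probability.\<close>

lemma R_single_le_boosted:
  assumes X: "finite X" and b: "boosted {..<m} X f \<gamma> t R" and \<gamma>: "1/2 < \<gamma>" "\<gamma> < 1" and t: "0 < t"
  shows "R_single m X f \<gamma> \<le> ennreal (240 * t)"
  unfolding R_single_def max_dist_R_def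
proof (rule SUP_least)
  fix \<mu> assume "\<mu> \<in> {\<mu>. set_pmf \<mu> \<subseteq> X}"
  then have \<mu>: "set_pmf \<mu> \<subseteq> X" by simp
  then have fin\<mu>: "finite (set_pmf \<mu>)" using X finite_subset by blast
  note [simp] = integrable_measure_pmf_finite[OF fin\<mu>]
  define d where "d = min (\<gamma> - 1/2) (1 - \<gamma>)"
  have d0: "0 < d" using \<gamma> by (simp add: d_def)
  from b have R: "R \<in> rand_algs {..<m} UNIV" "finite (set_pmf R)"
    and val: "\<And>x. x \<in> X \<Longrightarrow> \<gamma> + d / 80 + d / (240 * t) * mean_cost R x \<le> success R x (f x)"
    by (auto simp: boosted_def d_def)
  define P where "P = measure_pmf.expectation \<mu> (mean_cost R)"
  define s where "s = measure_pmf.expectation \<mu> (\<lambda>x. success R x (f x))"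
  have P0: "0 \<le> P" by (simp add: P_def integral_nonneg_AE)
  have "measure_pmf.expectation \<mu> (\<lambda>x. \<gamma> + d / (240 * t) * mean_cost R x) \<le> s"
    unfolding s_def
  proof (rule integral_mono_AE)
    show "AE x in \<mu>. \<gamma> + d / (240 * t) * mean_cost R x \<le> success R x (f x)"
    proof (rule AE_pmfI)
      fix x assume "x \<in> set_pmf \<mu>"
      then show "\<gamma> + d / (240 * t) * mean_cost R x \<le> success R x (f x)"
        using val[of x] \<mu> d0 by auto
    qed
  qed simp_all
  then have s: "\<gamma> + d / (240 * t) * P \<le> s" by (simp add: P_def)
  have s1: "s \<le> 1" unfolding s_def
    by (rule measure_pmf.integral_le_const) simp_all
  \<comment> \<open>In the second case the advantage over 1/2 is at least
    \<open>d * (1 + P / (240 * t))\<close>; scaling by the inverse of the bracket leaves advantage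
    \<open>d\<close> and brings the cost \<open>P\<close> below \<open>240 * t\<close>.\<close>
  define \<alpha> where "\<alpha> = (if 1 - \<gamma> \<le> \<gamma> - 1/2 then 1 else 1 / (1 + P / (240 * t)))"
  have "1 \<le> 1 + P / (240 * t)" using P0 t by simp
  then have \<alpha>: "0 \<le> \<alpha>" "\<alpha> \<le> 1" by (auto simp: \<alpha>_def divide_le_eq_1)
  have goal: "\<gamma> \<le> \<alpha> * s + (1 - \<alpha>) / 2 \<and> \<alpha> * P \<le> 240 * t"
  proof (cases "1 - \<gamma> \<le> \<gamma> - 1/2")
    case True
    then have d: "d = 1 - \<gamma>" by (simp add: d_def)
    then have "d / (240 * t) * P \<le> d" using s s1 by simp
    then have "P \<le> 240 * t" using d0 t by (simp add: field_simps)
    moreover have "0 \<le> d / (240 * t) * P" using d0 t P0 by simp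
    ultimately show ?thesis using s True by (simp add: \<alpha>_def)
  next
    case False
    then have d: "d = \<gamma> - 1/2" by (simp add: d_def)
    have pos: "0 < 1 + P / (240 * t)" using P0 t by (simp add: add_pos_nonneg)
    have \<alpha>': "\<alpha> * (1 + P / (240 * t)) = 1" using False pos by (simp add: \<alpha>_def)
    have "d * (\<alpha> * (1 + P / (240 * t))) = \<alpha> * (d + d / (240 * t) * P)" by (simp add: algebra_simps)
    also have "\<dots> \<le> \<alpha> * (s - 1/2)" using s \<alpha> by (intro mult_left_mono) (auto simp: d)
    finally have "d \<le> \<alpha> * (s - 1/2)" by (simp add: \<alpha>')
    moreover have "\<alpha> * P = 240 * t * (\<alpha> * (1 + P / (240 * t)) - \<alpha>)" using t by (simp add: field_simps)
    then have "\<alpha> * P \<le> 240 * t" unfolding \<alpha>' using t \<alpha> by (simp add: mult_left_le)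
    ultimately show ?thesis unfolding d right_diff_distrib diff_divide_distrib by linarith
  qed
  define R' where "R' = bind_pmf (bernoulli_pmf \<alpha>) (\<lambda>go. if go then R else guess)"
  have R': "finite (set_pmf R')" "R' \<in> rand_algs {..<m} UNIV"
    using R by (auto simp: R'_def rand_algs_def dest: queries_guess split: if_splits)
  have "success R' x y = \<alpha> * success R x y + (1 - \<alpha>) / 2" for x y
    using \<alpha> by (simp add: R'_def success_bind)
  then have 1: "\<gamma> \<le> measure_pmf.prob (pair_pmf \<mu> R') {(x, D). dt_output D x = f x}"
    unfolding prob_pair_pmf_eq_success using goal by (simp add: s_def)
  have "mean_cost R' = (\<lambda>x. \<alpha> * mean_cost R x)"
    using \<alpha> R by (simp add: R'_def mean_cost_bind fun_eq_iff)
  then have 2: "(\<integral>\<^sup>+ (x, D). of_nat (dt_cost D x) \<partial>measure_pmf (pair_pmf \<mu> R')) \<le> ennreal (240 * t)"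
    unfolding nn_integral_pair_pmf_eq_mean_cost[OF fin\<mu> R'(1)] using goal
    by (intro ennreal_leI) (simp add: P_def)
  show "(INF R \<in> {R \<in> rand_algs {..<m} UNIV.
                   measure_pmf.prob (pair_pmf \<mu> R) {(x, D). dt_output D x = f x} \<ge> \<gamma>}.
          \<integral>\<^sup>+ (x, D). of_nat (dt_cost D x) \<partial>measure_pmf (pair_pmf \<mu> R)) \<le> ennreal (240 * t)"
    using 1 2 R'(2) by (intro INF_lower2[of R']) auto
qed

text \<open>With \<open>w\<close> as input distribution, some algorithm has success \<gamma> and
  mean cost below \<open>t\<close>; linearizing the discount bounds its value from below, and some
  tree in its support does as well as the average. The averaging is done with \<open>ennreal\<close>
  integrals, as the support may be infinite.\<close>

lemma discounted_tree_of_R_single: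
  assumes X: "finite X" and w: "\<And>x. 0 \<le> w x" "\<And>x. x \<notin> X \<Longrightarrow> w x = 0" "sum w X = 1"
    and t: "R_single m X f \<gamma> < ennreal t" "0 < t" and l: "0 < l"
  shows "\<exists>D. queries D \<subseteq> {..<m} \<and>
    \<gamma> - l * t \<le> (\<Sum>x\<in>X. w x * (of_bool (dt_output D x = f x) * exp (- l) ^ dt_cost D x))"
proof (rule ccontr)
  assume contr: "\<not> ?thesis"
  have "(\<integral>\<^sup>+x. ennreal (w x) \<partial>count_space UNIV) = (\<integral>\<^sup>+x. ennreal (w x) \<partial>count_space X)"
    using w(2) by (intro nn_integral_count_space_eq) auto
  also have "\<dots> = 1"
    using X w by (simp add: nn_integral_count_space_finite sum_ennreal)
  finally have w1: "(\<integral>\<^sup>+x. ennreal (w x) \<partial>count_space UNIV) = 1" .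
  define \<mu> where "\<mu> = embed_pmf w"
  have pmf_\<mu>: "pmf \<mu> x = w x" for x
    unfolding \<mu>_def by (rule pmf_embed_pmf[OF w(1) w1])
  have \<mu>: "set_pmf \<mu> \<subseteq> X"
    using w(2) unfolding set_pmf_eq pmf_\<mu> by blast
  have "(INF R \<in> {R \<in> rand_algs {..<m} UNIV.
           measure_pmf.prob (pair_pmf \<mu> R) {(x, D). dt_output D x = f x} \<ge> \<gamma>}.
          \<integral>\<^sup>+ (x, D). of_nat (dt_cost D x) \<partial>measure_pmf (pair_pmf \<mu> R)) < ennreal t"
    using \<mu> by (intro le_less_trans[OF SUP_upper t(1)[unfolded R_single_def max_dist_R_def]]) simp
  then obtain R where R: "R \<in> rand_algs {..<m} UNIV"
    and suc: "\<gamma> \<le> measure_pmf.prob (pair_pmf \<mu> R) {(x, D). dt_output D x = f x}"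
    and cost: "(\<integral>\<^sup>+ (x, D). of_nat (dt_cost D x) \<partial>measure_pmf (pair_pmf \<mu> R)) < ennreal t"
    by (auto simp: INF_less_iff)
  let ?M = "measure_pmf (pair_pmf \<mu> R)"
  define a where "a = (\<lambda>(x, D). of_bool (dt_output D x = f x) :: real)"
  define c where "c = (\<lambda>(x, D :: (nat, bool) dtree). real (dt_cost D x))"
  define g where "g p = a p * exp (- l) ^ (dt_cost (snd p) (fst p))" for p
  have a01: "a p = 0 \<or> a p = 1" for p by (cases p) (auto simp: a_def)
  have g01: "0 \<le> g p" "g p \<le> 1" for p
    using a01[of p] l by (auto simp: g_def power_le_one)
  have inta: "integrable ?M a"
    by (intro measure_pmf.integrable_const_bound[where B = 1]) (auto simp: a_def case_prod_beta')
  have intg: "integrable ?M g"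
    using g01 by (intro measure_pmf.integrable_const_bound[where B = 1]) auto
  have nnc: "(\<integral>\<^sup>+ p. ennreal (c p) \<partial>?M) < ennreal t"
    using cost by (simp add: c_def case_prod_beta' ennreal_of_nat_eq_real_of_nat)
  have c0: "0 \<le> c p" for p by (simp add: c_def case_prod_beta')
  have intc: "integrable ?M c"
    using nnc c0 by (intro integrableI_nonneg) (auto intro: less_trans)
  have Ec: "integral\<^sup>L ?M c < t"
    using nnc nn_integral_eq_integral[OF intc] c0 t(2) by (simp add: ennreal_less_iff integral_nonneg_AE)
  have "a = indicator {(x, D). dt_output D x = f x}"
    by (auto simp: a_def fun_eq_iff indicator_def)
  then have Ea: "\<gamma> \<le> integral\<^sup>L ?M a" using suc by simp
  have "a p - l * c p \<le> g p" for p
  proof -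
    have "1 + - (l * c p) \<le> exp (- (l * c p))" by (rule exp_ge_add_one_self)
    also have "\<dots> = exp (- l) ^ dt_cost (snd p) (fst p)"
      by (simp add: c_def case_prod_beta' exp_of_nat_mult[symmetric] mult.commute)
    finally show ?thesis
      using a01[of p] c0[of p] l by (auto simp: g_def)
  qed
  then have "integral\<^sup>L ?M (\<lambda>p. a p - l * c p) \<le> integral\<^sup>L ?M g"
    using inta intc intg by (intro integral_mono) auto
  then have "integral\<^sup>L ?M a - l * integral\<^sup>L ?M c \<le> integral\<^sup>L ?M g"
    using inta intc by simp
  moreover have "l * integral\<^sup>L ?M c < l * t" using Ec l by simp
  ultimately have Eg: "\<gamma> - l * t < integral\<^sup>L ?M g" using Ea by linarith
  have inner: "(\<integral>\<^sup>+ x. ennreal (g (x, D)) \<partial>measure_pmf \<mu>) \<le> ennreal (\<gamma> - l * t)"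
    if D: "D \<in> set_pmf R" for D
  proof -
    have "(\<integral>\<^sup>+ x. ennreal (g (x, D)) \<partial>measure_pmf \<mu>) = ennreal (measure_pmf.expectation \<mu> (\<lambda>x. g (x, D)))"
      using g01 finite_subset[OF \<mu> X]
      by (intro nn_integral_eq_integral integrable_measure_pmf_finite) auto
    also have "measure_pmf.expectation \<mu> (\<lambda>x. g (x, D)) = (\<Sum>x\<in>X. w x * g (x, D))"
      using \<mu> by (subst integral_measure_pmf[OF X]) (auto simp: pmf_\<mu>)
    also have "\<dots> = (\<Sum>x\<in>X. w x * (of_bool (dt_output D x = f x) * exp (- l) ^ dt_cost D x))"
      by (simp add: g_def a_def)
    also have "\<dots> \<le> \<gamma> - l * t"
      using contr D R by (force simp: rand_algs_def not_le)
    finally show ?thesis by (simp add: ennreal_leI)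
  qed
  have "ennreal (integral\<^sup>L ?M g) = (\<integral>\<^sup>+ p. ennreal (g p) \<partial>?M)"
    using g01 by (intro nn_integral_eq_integral[symmetric] intg) auto
  also have "\<dots> = (\<integral>\<^sup>+ D. \<integral>\<^sup>+ x. ennreal (g (x, D)) \<partial>measure_pmf \<mu> \<partial>measure_pmf R)"
    by (subst pair_commute_pmf) (simp add: nn_integral_pair_pmf' case_prod_beta')
  also have "\<dots> \<le> (\<integral>\<^sup>+ D. ennreal (\<gamma> - l * t) \<partial>measure_pmf R)"
    using inner by (intro nn_integral_mono_AE) (auto simp: AE_measure_pmf_iff)
  also have "\<dots> = ennreal (\<gamma> - l * t)" by (simp add: measure_pmf.emeasure_space_1[simplified])
  finally have "ennreal (integral\<^sup>L ?M g) \<le> ennreal (\<gamma> - l * t)" .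
  moreover have "0 \<le> integral\<^sup>L ?M g" using g01 by (simp add: integral_nonneg_AE)
  \<comment> \<open>\<open>ennreal\<close> truncates at 0; for a nonpositive target any constant
    tree is a witness.\<close>
  ultimately have "integral\<^sup>L ?M g \<le> \<gamma> - l * t \<or> integral\<^sup>L ?M g = 0 \<and> \<gamma> - l * t \<le> 0"
    by (cases "0 \<le> \<gamma> - l * t") (auto simp: ennreal_neg)
  then show False
  proof
    assume "integral\<^sup>L ?M g = 0 \<and> \<gamma> - l * t \<le> 0"
    moreover have "0 \<le> (\<Sum>x\<in>X. w x * (of_bool (dt_output (Answer True) x = f x) * exp (- l) ^ dt_cost (Answer True) x))"
      using w(1) by (intro sum_nonneg) auto
    ultimately show False using contr by (auto intro!: exI[of _ "Answer True"] dest!: spec[of _ "Answer True"])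
  qed (use Eg in simp)
qed

section \<open>Decoupling the blocks\<close>

text \<open>The inverse of splitting into blocks. Keeping the blocks as a function of
  \<open>k\<close> lets sums over product inputs factor by \<open>prod_sum_PiE\<close>.\<close>

definition join :: "nat \<Rightarrow> nat \<Rightarrow> (nat \<Rightarrow> nat \<Rightarrow> bool) \<Rightarrow> (nat \<times> nat \<Rightarrow> bool)" where
  "join m n y = (\<lambda>(k, i)\<in>{..<n} \<times> {..<m}. y k i)"

lemma join_apply [simp]: "k < n \<Longrightarrow> i < m \<Longrightarrow> join m n y (k, i) = y k i"
  by (simp add: join_def)

lemma block_join:
  assumes "k < n" "y k \<in> {..<m} \<rightarrow>\<^sub>E UNIV"
  shows "block m (join m n y) k = y k"
  using assms by (auto simp: block_def fun_eq_iff restrict_def PiE_def extensional_def)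

lemma join_in_power_dom:
  assumes "X \<subseteq> {..<m} \<rightarrow>\<^sub>E UNIV" "y \<in> {..<n} \<rightarrow>\<^sub>E X"
  shows "join m n y \<in> power_dom m n X"
proof -
  have "block m (join m n y) k \<in> X" if "k < n" for k
    using that assms by (subst block_join) (auto simp: PiE_iff)
  moreover have "join m n y \<in> {..<n} \<times> {..<m} \<rightarrow>\<^sub>E UNIV"
    by (simp add: join_def)
  ultimately show ?thesis by (simp add: power_dom_def)
qed

lemma direct_product_join:
  assumes "X \<subseteq> {..<m} \<rightarrow>\<^sub>E UNIV" "y \<in> {..<n} \<rightarrow>\<^sub>E X"
  shows "direct_product m n f (join m n y) = (\<lambda>k\<in>{..<n}. f (y k))"
proof -
  have "block m (join m n y) k = y k" if "k < n" for k
    using that assms by (intro block_join) (auto simp: PiE_iff)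
  then show ?thesis by (auto simp: direct_product_def intro!: restrict_ext)
qed

text \<open>The weights \<open>w\<close> are not normalized: conditioning on a query answer just
  sets part of them to 0, which makes the value split additively at a query.\<close>

definition discounted ::
  "('i \<Rightarrow> bool) set \<Rightarrow> (('i \<Rightarrow> bool) \<Rightarrow> bool) \<Rightarrow> real \<Rightarrow> ('i, bool) dtree \<Rightarrow> (('i \<Rightarrow> bool) \<Rightarrow> real) \<Rightarrow> real" where
  "discounted X f q D w = (\<Sum>x\<in>X. w x * (of_bool (dt_output D x = f x) * q ^ dt_cost D x))"

lemma discounted_nonneg: "(\<And>x. 0 \<le> w x) \<Longrightarrow> 0 \<le> q \<Longrightarrow> 0 \<le> discounted X f q D w"
  unfolding discounted_def by (intro sum_nonneg mult_nonneg_nonneg) auto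

lemma discounted_Query:
  "discounted X f q (Query i l r) w =
    q * (discounted X f q l (\<lambda>x. of_bool (\<not> x i) * w x) + discounted X f q r (\<lambda>x. of_bool (x i) * w x))"
  unfolding discounted_def sum.distrib[symmetric] sum_distrib_left
  by (intro sum.cong) auto

text \<open>
  Discounting by \<open>q\<close> per query replaces the shared query budget by a price, so that the best value on
  a product of weights is the product of the best values on the factors.
\<close>

lemma decoupling:
  fixes D :: "(nat \<times> nat, nat \<Rightarrow> bool) dtree"
  assumes X: "finite X" and q: "0 \<le> q" and w: "\<And>k x. 0 \<le> w k x"
    and D: "queries D \<subseteq> {..<n} \<times> {..<m}"
  shows "\<exists>D'. (\<forall>k<n. queries (D' k) \<subseteq> {..<m}) \<and>
    (\<Sum>y \<in> {..<n} \<rightarrow>\<^sub>E X. (\<Prod>k<n. w k (y k)) *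
       (of_bool (dt_output D (join m n y) = (\<lambda>k\<in>{..<n}. f (y k))) * q ^ dt_cost D (join m n y)))
    \<le> (\<Prod>k<n. discounted X f q (D' k) (w k))"
  using w D
proof (induction D arbitrary: w)
  case (Answer a)
  \<comment> \<open>At a leaf the indicator of a correct string is at most the product of the
    blockwise indicators.\<close>
  have "(\<Sum>y \<in> {..<n} \<rightarrow>\<^sub>E X. (\<Prod>k<n. w k (y k)) * of_bool (a = (\<lambda>k\<in>{..<n}. f (y k))))
      \<le> (\<Sum>y \<in> {..<n} \<rightarrow>\<^sub>E X. \<Prod>k<n. w k (y k) * of_bool (a k = f (y k)))"
  proof (intro sum_mono)
    fix y
    show "(\<Prod>k<n. w k (y k)) * of_bool (a = (\<lambda>k\<in>{..<n}. f (y k)))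
        \<le> (\<Prod>k<n. w k (y k) * of_bool (a k = f (y k)))"
    proof (cases "a = (\<lambda>k\<in>{..<n}. f (y k))")
      case True
      then show ?thesis by simp
    next
      case False
      then show ?thesis using Answer.prems by (auto intro!: prod_nonneg)
    qed
  qed
  also have "\<dots> = (\<Prod>k<n. discounted X f q (Answer (a k)) (w k))"
    unfolding discounted_def by (subst prod_sum_PiE) (use X in auto)
  finally show ?case
    by (intro exI[of _ "\<lambda>k. Answer (a k)"] conjI allI impI)
      (simp_all only: dt_output.simps dt_cost.simps power_0 mult_1_right dtree.set empty_subsetI)
next
  case (Query p l r)
  obtain k0 i0 where p: "p = (k0, i0)" by (cases p)
  with Query.prems have ki: "k0 < n" "i0 < m"
    and ql: "queries l \<subseteq> {..<n} \<times> {..<m}" and qr: "queries r \<subseteq> {..<n} \<times> {..<m}" by auto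
  \<comment> \<open>A query to block \<open>k0\<close> restricts the weight of that block only and
    leaves the product form intact.\<close>
  define w0 where "w0 = w(k0 := \<lambda>x. of_bool (\<not> x i0) * w k0 x)"
  define w1 where "w1 = w(k0 := \<lambda>x. of_bool (x i0) * w k0 x)"
  have w0: "0 \<le> w0 k x" and w1: "0 \<le> w1 k x" for k x
    using Query.prems(1) by (simp_all add: w0_def w1_def)
  let ?v = "\<lambda>D y. of_bool (dt_output D (join m n y) = (\<lambda>k\<in>{..<n}. f (y k))) * q ^ dt_cost D (join m n y)"
  let ?S = "\<lambda>w D. \<Sum>y \<in> {..<n} \<rightarrow>\<^sub>E X. (\<Prod>k<n. w k (y k)) * ?v D y"
  let ?d = "discounted X f q"
  obtain L where L: "\<forall>k<n. queries (L k) \<subseteq> {..<m}" "?S w0 l \<le> (\<Prod>k<n. ?d (L k) (w0 k))"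
    using Query.IH(1)[of w0, OF w0 ql] by (elim exE conjE) (rule that)
  obtain R where R: "\<forall>k<n. queries (R k) \<subseteq> {..<m}" "?S w1 r \<le> (\<Prod>k<n. ?d (R k) (w1 k))"
    using Query.IH(2)[of w1, OF w1 qr] by (elim exE conjE) (rule that)
  have split: "(\<Prod>k<n. F k) = F k0 * (\<Prod>k\<in>{..<n} - {k0}. F k)" for F :: "nat \<Rightarrow> real"
    using ki by (intro prod.remove) auto
  have p0: "(\<Prod>k<n. w0 k (y k)) = of_bool (\<not> y k0 i0) * (\<Prod>k<n. w k (y k))" for y
    unfolding split by (simp add: w0_def)
  have p1: "(\<Prod>k<n. w1 k (y k)) = of_bool (y k0 i0) * (\<Prod>k<n. w k (y k))" for y
    unfolding split by (simp add: w1_def)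
  have "(\<Prod>k<n. w k (y k)) * ?v (Query p l r) y =
      q * ((\<Prod>k<n. w0 k (y k)) * ?v l y + (\<Prod>k<n. w1 k (y k)) * ?v r y)" for y
    unfolding p0 p1 p using ki by (cases "y k0 i0") simp_all
  then have "?S w (Query p l r) = q * (?S w0 l + ?S w1 r)"
    unfolding sum.distrib[symmetric] sum_distrib_left by (intro sum.cong refl)
  also have "\<dots> \<le> q * ((\<Prod>k<n. ?d (L k) (w0 k)) + (\<Prod>k<n. ?d (R k) (w1 k)))"
    using L(2) R(2) q by (intro mult_left_mono add_mono) auto
  also have "\<dots> = q * (?d (L k0) (w0 k0) * (\<Prod>k\<in>{..<n} - {k0}. ?d (L k) (w k)) +
      ?d (R k0) (w1 k0) * (\<Prod>k\<in>{..<n} - {k0}. ?d (R k) (w k)))"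
    unfolding split by (simp add: w0_def w1_def)
  finally have S: "?S w (Query p l r) \<le> \<dots>" .
  \<comment> \<open>Other blocks carry the same weight in both branches, so the better of their two
    trees serves both. The two products then share a factor, and block \<open>k0\<close> recombines
    through \<open>discounted_Query\<close>.\<close>
  define D' where "D' k = (if k = k0 then Query i0 (L k0) (R k0)
     else if ?d (R k) (w k) \<le> ?d (L k) (w k) then L k else R k)" for k
  have "?d (L k) (w k) \<le> ?d (D' k) (w k)" "?d (R k) (w k) \<le> ?d (D' k) (w k)" if "k \<noteq> k0" for k
    using that by (auto simp: D'_def)
  moreover have "0 \<le> ?d D (w k)" for D k
    by (rule discounted_nonneg[OF Query.prems(1) q])
  ultimately have "(\<Prod>k\<in>{..<n} - {k0}. ?d (L k) (w k)) \<le> (\<Prod>k\<in>{..<n} - {k0}. ?d (D' k) (w k))"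
    "(\<Prod>k\<in>{..<n} - {k0}. ?d (R k) (w k)) \<le> (\<Prod>k\<in>{..<n} - {k0}. ?d (D' k) (w k))"
    by (auto intro!: prod_mono)
  moreover have "0 \<le> ?d (L k0) (w0 k0)" "0 \<le> ?d (R k0) (w1 k0)"
    using Query.prems(1) q by (auto intro!: discounted_nonneg simp: w0_def w1_def)
  ultimately have "q * (?d (L k0) (w0 k0) * (\<Prod>k\<in>{..<n} - {k0}. ?d (L k) (w k)) +
      ?d (R k0) (w1 k0) * (\<Prod>k\<in>{..<n} - {k0}. ?d (R k) (w k)))
    \<le> q * (?d (L k0) (w0 k0) * (\<Prod>k\<in>{..<n} - {k0}. ?d (D' k) (w k)) +
      ?d (R k0) (w1 k0) * (\<Prod>k\<in>{..<n} - {k0}. ?d (D' k) (w k)))"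
    using q by (intro mult_left_mono add_mono) auto
  also have "\<dots> = ?d (D' k0) (w k0) * (\<Prod>k\<in>{..<n} - {k0}. ?d (D' k) (w k))"
    by (simp add: D'_def discounted_Query w0_def w1_def algebra_simps)
  also have "\<dots> = (\<Prod>k<n. ?d (D' k) (w k))" unfolding split ..
  finally have "?S w (Query p l r) \<le> (\<Prod>k<n. ?d (D' k) (w k))" using S by linarith
  moreover have "\<forall>k<n. queries (D' k) \<subseteq> {..<m}"
    using L(1) R(1) ki by (auto simp: D'_def)
  ultimately show ?case by (intro exI[of _ D'] conjI)
qed

text \<open>With all blocks drawn independently from \<open>w\<close>, some tree in the support
  succeeds with probability \<gamma> ^ n. At most \<open>T\<close> queries discount this by at most
  \<open>q ^ T\<close>, and decoupling bounds the result by a product of \<open>n\<close> values of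
  single trees, so one factor is at least its \<open>n\<close>-th root.\<close>

lemma discounted_tree_of_power_alg:
  assumes X: "X \<subseteq> {..<m} \<rightarrow>\<^sub>E UNIV"
    and w: "\<And>x. 0 \<le> w x" "sum w X = 1"
    and R: "R \<in> rand_algs ({..<n} \<times> {..<m}) L"
    and suc: "\<And>z. z \<in> power_dom m n X \<Longrightarrow> \<gamma> ^ n \<le> success R z (direct_product m n f z)"
    and cost: "\<And>z D. z \<in> power_dom m n X \<Longrightarrow> D \<in> set_pmf R \<Longrightarrow> dt_cost D z \<le> T"
    and t: "real T < real n * t" and \<gamma>: "0 < \<gamma>" "\<gamma> \<le> 1" and l: "0 < l" and t0: "0 \<le> t"
  shows "\<exists>D. queries D \<subseteq> {..<m} \<and> \<gamma> - l * t \<le> discounted X f (exp (- l)) D w"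
proof -
  have finX: "finite X" using X finite_PiE_bool finite_subset by blast
  define q where "q = exp (- l)"
  have q: "0 < q" "q \<le> 1" using l by (auto simp: q_def)
  let ?Y = "{..<n} \<rightarrow>\<^sub>E X"
  let ?a = "\<lambda>D y. of_bool (dt_output D (join m n y) = (\<lambda>k\<in>{..<n}. f (y k))) :: real"
  define S where "S D = (\<Sum>y\<in>?Y. (\<Prod>k<n. w (y k)) * ?a D y)" for D
  have inta: "integrable (measure_pmf R) (\<lambda>D. ?a D y)" for y
    by (intro measure_pmf.integrable_const_bound[where B = 1]) auto
  have "measure_pmf.expectation R S = (\<Sum>y\<in>?Y. (\<Prod>k<n. w (y k)) * measure_pmf.expectation R (\<lambda>D. ?a D y))"
    unfolding S_def using inta by (subst Bochner_Integration.integral_sum) auto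
  also have "\<dots> \<ge> (\<Sum>y\<in>?Y. (\<Prod>k<n. w (y k)) * \<gamma> ^ n)"
  proof (intro sum_mono mult_left_mono)
    fix y assume y: "y \<in> ?Y"
    have "\<gamma> ^ n \<le> success R (join m n y) (direct_product m n f (join m n y))"
      using X y by (intro suc join_in_power_dom)
    then show "\<gamma> ^ n \<le> measure_pmf.expectation R (\<lambda>D. ?a D y)"
      unfolding direct_product_join[OF X y] success_eq_expectation .
  qed (use w in \<open>auto intro!: prod_nonneg\<close>)
  also have "(\<Sum>y\<in>?Y. (\<Prod>k<n. w (y k)) * \<gamma> ^ n) = (\<Prod>k<n. sum w X) * \<gamma> ^ n"
    unfolding sum_distrib_right[symmetric] by (subst prod_sum_PiE) (use finX in auto)
  also have "\<dots> = \<gamma> ^ n" by (simp add: w(2))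
  finally have ES: "\<gamma> ^ n \<le> measure_pmf.expectation R S" .
  have intS: "integrable (measure_pmf R) S"
    unfolding S_def using inta by auto
  have "\<exists>D\<in>set_pmf R. \<gamma> ^ n \<le> S D"
  proof (rule ccontr)
    assume "\<not> ?thesis"
    then have "AE D in R. S D < \<gamma> ^ n" by (auto simp: AE_measure_pmf_iff not_le)
    then have "measure_pmf.expectation R S < \<gamma> ^ n"
      by (intro measure_pmf.expectation_less intS)
    with ES show False by simp
  qed
  then obtain D where D: "D \<in> set_pmf R" "\<gamma> ^ n \<le> S D" by blast
  have qD: "queries D \<subseteq> {..<n} \<times> {..<m}" using D(1) R by (auto simp: rand_algs_def)
  obtain D' where D': "\<forall>k<n. queries (D' k) \<subseteq> {..<m}"
    "(\<Sum>y\<in>?Y. (\<Prod>k<n. w (y k)) * (?a D y * q ^ dt_cost D (join m n y))) \<le> (\<Prod>k<n. discounted X f q (D' k) w)"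
    using decoupling[where w = "\<lambda>_. w" and f = f, OF finX less_imp_le[OF q(1)] w(1) qD]
    by (elim exE conjE) (rule that)
  have "q ^ T * \<gamma> ^ n \<le> q ^ T * S D" using D(2) q by (intro mult_left_mono) auto
  also have "\<dots> = (\<Sum>y\<in>?Y. (\<Prod>k<n. w (y k)) * (?a D y * q ^ T))"
    by (simp add: S_def sum_distrib_left mult_ac)
  also have "\<dots> \<le> (\<Sum>y\<in>?Y. (\<Prod>k<n. w (y k)) * (?a D y * q ^ dt_cost D (join m n y)))"
    using q w(1) cost[OF join_in_power_dom[OF X] D(1)]
    by (intro sum_mono mult_left_mono power_decreasing prod_nonneg) auto
  also note D'(2)
  finally have prod: "q ^ T * \<gamma> ^ n \<le> (\<Prod>k<n. discounted X f q (D' k) w)" .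
  have "\<exists>k<n. \<gamma> * exp (- (l * t)) \<le> discounted X f q (D' k) w"
  proof (rule ccontr)
    assume "\<not> ?thesis"
    then have "(\<Prod>k<n. discounted X f q (D' k) w) \<le> (\<Prod>k<n. \<gamma> * exp (- (l * t)))"
      using w(1) q by (intro prod_mono conjI discounted_nonneg) (auto simp: not_le less_imp_le)
    also have "\<dots> = \<gamma> ^ n * exp (- (l * (real n * t)))"
      by (simp add: power_mult_distrib exp_of_nat_mult[symmetric] mult_ac)
    \<comment> \<open>The product comparison is only weak; strictness comes from
      \<open>T < n * t\<close>.\<close>
    also have "\<dots> < \<gamma> ^ n * exp (- (l * real T))"
      using t l \<gamma> by simp
    also have "\<dots> = q ^ T * \<gamma> ^ n"
      by (simp add: q_def exp_of_nat_mult[symmetric] mult_ac)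
    finally show False using prod by simp
  qed
  then obtain k where k: "k < n" "\<gamma> * exp (- (l * t)) \<le> discounted X f q (D' k) w" by blast
  have "\<gamma> * (1 + - (l * t)) \<le> \<gamma> * exp (- (l * t))"
    using \<gamma> by (intro mult_left_mono exp_ge_add_one_self) auto
  moreover have "\<gamma> * (l * t) \<le> 1 * (l * t)" using \<gamma> l t0 by (intro mult_right_mono) auto
  ultimately have "\<gamma> - l * t \<le> discounted X f q (D' k) w"
    using k(2) by (simp add: algebra_simps)
  then show ?thesis using D'(1) k(1) q_def by blast
qed

section \<open>The two inequalities, with \<open>t\<close> approaching its bound from above\<close>

lemma R_power_ge:
  assumes X: "X \<subseteq> {..<m} \<rightarrow>\<^sub>E UNIV" and \<gamma>: "1/2 < \<gamma>" "\<gamma> < 1" and n: "1 \<le> n"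
  shows "ennreal (1/240) * of_nat n * R_single m X f \<gamma> \<le> R_power m n X f (\<gamma> ^ n)"
  unfolding R_power_def worst_case_R_def
proof (rule INF_greatest)
  fix R :: "(nat \<times> nat, nat \<Rightarrow> bool) dtree pmf"
  let ?c = "SUP z\<in>power_dom m n X. SUP D\<in>set_pmf R. of_nat (dt_cost D z) :: ennreal"
  assume "R \<in> {R \<in> rand_algs ({..<n} \<times> {..<m}) ({..<n} \<rightarrow>\<^sub>E UNIV).
    \<forall>z\<in>power_dom m n X. \<gamma> ^ n \<le> measure_pmf.prob R {D. dt_output D z = direct_product m n f z}}"
  then have R: "R \<in> rand_algs ({..<n} \<times> {..<m}) ({..<n} \<rightarrow>\<^sub>E UNIV)"
    and suc: "\<And>z. z \<in> power_dom m n X \<Longrightarrow> \<gamma> ^ n \<le> success R z (direct_product m n f z)"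
    by (auto simp: success_eq_prob)
  have finX: "finite X" using X finite_PiE_bool finite_subset by blast
  define d where "d = min (\<gamma> - 1/2) (1 - \<gamma>)"
  have d0: "0 < d" using \<gamma> by (simp add: d_def)
  show "ennreal (1/240) * of_nat n * R_single m X f \<gamma> \<le> ?c"
  proof (cases "?c = \<top>")
    case True
    show ?thesis unfolding True by (rule top_greatest)
  next
    case False
    then obtain c where c: "?c = ennreal c" "0 \<le> c" by (cases ?c) auto
    define T where "T = nat \<lfloor>c\<rfloor>"
    have cost: "dt_cost D z \<le> T" if "z \<in> power_dom m n X" "D \<in> set_pmf R" for z D
    proof -
      have "of_nat (dt_cost D z) \<le> ?c" using that by (intro SUP_upper2[of z] SUP_upper2[of D]) auto
      then have "real (dt_cost D z) \<le> c" using c by (simp add: ennreal_of_nat_eq_real_of_nat)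
      then show ?thesis by (simp add: T_def le_nat_floor)
    qed
    have T: "real T \<le> c" using c by (simp add: T_def)
    \<comment> \<open>Every \<open>t\<close> above the cost per block is admissible; the rate
      \<open>d / (20 * t)\<close> makes the total loss \<open>d / 20\<close> as
      \<open>boosting\<close> requires. The slack \<open>e\<close> below then removes the strict
      inequality.\<close>
    have "R_single m X f \<gamma> \<le> ennreal (240 * t)" if t: "c / real n < t" for t
    proof -
      have t0: "0 < t" using t c(2) n by (meson divide_nonneg_nonneg le_less_trans of_nat_0_le_iff)
      have nt: "real T < real n * t" using t T n by (simp add: pos_divide_less_eq mult.commute)
      have "\<exists>R. boosted {..<m} X f \<gamma> t R"
      proof (rule boosting[OF finX \<gamma> t0 d_def refl])
        fix w :: "(nat \<Rightarrow> bool) \<Rightarrow> real"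
        assume w: "\<And>x. 0 \<le> w x" "sum w X = 1"
        have "\<exists>D. queries D \<subseteq> {..<m} \<and>
            \<gamma> - d / (20 * t) * t \<le> discounted X f (exp (- (d / (20 * t)))) D w"
          using \<gamma> d0 t0 by (intro discounted_tree_of_power_alg[where w = w, OF X w R suc cost nt]) auto
        then show "\<exists>D. queries D \<subseteq> {..<m} \<and> \<gamma> - d / 20 \<le>
            (\<Sum>x\<in>X. w x * (of_bool (dt_output D x = f x) * exp (- (d / (20 * t))) ^ dt_cost D x))"
          using t0 by (simp add: discounted_def)
      qed
      then obtain R' where "boosted {..<m} X f \<gamma> t R'" ..
      then show ?thesis by (rule R_single_le_boosted[OF finX _ \<gamma> t0])
    qed
    then have "R_single m X f \<gamma> \<le> ennreal (240 * (c / real n)) + ennreal e" if "0 < e" for e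
    proof -
      have "R_single m X f \<gamma> \<le> ennreal (240 * (c / real n + e / 240))"
        using that by (intro \<open>\<And>t. c / real n < t \<Longrightarrow> R_single m X f \<gamma> \<le> ennreal (240 * t)\<close>) simp
      also have "\<dots> = ennreal (240 * (c / real n) + e)" by (simp add: algebra_simps)
      also have "\<dots> = ennreal (240 * (c / real n)) + ennreal e"
        using that c(2) by (intro ennreal_plus) auto
      finally show ?thesis .
    qed
    then have "R_single m X f \<gamma> \<le> ennreal (240 * (c / real n))"
      by (rule ennreal_le_epsilon)
    then have "ennreal (1/240) * of_nat n * R_single m X f \<gamma> \<le>
        ennreal (1/240) * of_nat n * ennreal (240 * (c / real n))"
      by (intro mult_left_mono) auto
    also have "\<dots> = ennreal (1/240 * real n * (240 * (c / real n)))"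
      unfolding ennreal_of_nat_eq_real_of_nat
      using divide_nonneg_nonneg[OF c(2) of_nat_0_le_iff[of n]] by (simp only: ennreal_mult)
    also have "1/240 * real n * (240 * (c / real n)) = c" using n by simp
    finally show ?thesis using c by simp
  qed
qed

lemma R_power_le:
  assumes X: "X \<subseteq> {..<m} \<rightarrow>\<^sub>E UNIV" and \<gamma>: "1/2 < \<gamma>" "\<gamma> < 1"
    and n: "80 / (min (2 * \<gamma> - 1) (1 - \<gamma>))\<^sup>2 \<le> real n"
  shows "R_power m n X f (\<gamma> ^ n) \<le> ennreal 960 * of_nat n * R_single m X f \<gamma>"
proof -
  have finX: "finite X" using X finite_PiE_bool finite_subset by blast
  define d where "d = min (\<gamma> - 1/2) (1 - \<gamma>)"
  define e where "e = min (2 * \<gamma> - 1) (1 - \<gamma>)"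
  have d0: "0 < d" using \<gamma> by (simp add: d_def)
  have e: "0 < e" "e \<le> 2 * d" "2 * e \<le> 1" using \<gamma> by (auto simp: d_def e_def min_def)
  \<comment> \<open>The hypothesis on \<open>n\<close> is quadratic in \<open>e\<close>, while the
    construction needs \<open>80 \<le> n * d\<close>; \<open>e * e \<le> d\<close> follows from
    \<open>e \<le> 2 * d\<close> and \<open>e \<le> 1/2\<close>.\<close>
  have "80 \<le> real n * e\<^sup>2" using n e by (simp add: e_def[symmetric] pos_divide_le_eq)
  also have "\<dots> = real n * (e * e)" by (simp add: power2_eq_square)
  also have "\<dots> \<le> real n * (2 * d * (1/2))" using e by (intro mult_left_mono mult_mono) auto
  finally have nd: "80 \<le> real n * d" by simp
  then have n0: "0 < real n" using d0 by (cases n) auto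
  show ?thesis
  proof (cases "R_single m X f \<gamma> = \<top>")
    case True
    then show ?thesis using n0 by (simp add: ennreal_mult_top ennreal_mult_eq_top_iff)
  next
    case False
    then obtain r where r: "R_single m X f \<gamma> = ennreal r" "0 \<le> r" by (cases "R_single m X f \<gamma>") auto
    \<comment> \<open>Strictness of \<open>r < t\<close> both makes \<open>t\<close> positive and
      yields an algorithm below the infimum bound for every input distribution.\<close>
    have bound: "R_power m n X f (\<gamma> ^ n) \<le> ennreal (960 * t * real n)" if t: "r < t" for t
    proof -
      have t0: "0 < t" using t r by simp
      have lt: "R_single m X f \<gamma> < ennreal t" using t r by (simp add: ennreal_less_iff)
      have "\<exists>R. boosted {..<m} X f \<gamma> t R"
      proof (rule boosting[OF finX \<gamma> t0 d_def refl])
        fix w :: "(nat \<Rightarrow> bool) \<Rightarrow> real"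
        assume w: "\<And>x. 0 \<le> w x" "\<And>x. x \<notin> X \<Longrightarrow> w x = 0" "sum w X = 1"
        have "\<exists>D. queries D \<subseteq> {..<m} \<and> \<gamma> - d / (20 * t) * t \<le>
            (\<Sum>x\<in>X. w x * (of_bool (dt_output D x = f x) * exp (- (d / (20 * t))) ^ dt_cost D x))"
          using d0 t0 by (intro discounted_tree_of_R_single[where w = w, OF finX w lt]) auto
        then show "\<exists>D. queries D \<subseteq> {..<m} \<and> \<gamma> - d / 20 \<le>
            (\<Sum>x\<in>X. w x * (of_bool (dt_output D x = f x) * exp (- (d / (20 * t))) ^ dt_cost D x))"
          using t0 by simp
      qed
      then obtain R' where "boosted {..<m} X f \<gamma> t R'" ..
      then show ?thesis by (rule R_power_le_boosted[OF _ \<gamma> t0 d_def nd])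
    qed
    have "R_power m n X f (\<gamma> ^ n) \<le> ennreal (960 * r * real n) + ennreal e" if e: "0 < e" for e
    proof -
      have "R_power m n X f (\<gamma> ^ n) \<le> ennreal (960 * (r + e / (960 * real n)) * real n)"
        using e n0 by (intro bound) simp
      also have "960 * (r + e / (960 * real n)) * real n = 960 * r * real n + e"
        using n0 by (simp add: field_simps)
      also have "ennreal \<dots> = ennreal (960 * r * real n) + ennreal e"
        using e r(2) by (intro ennreal_plus) auto
      finally show ?thesis .
    qed
    then have "R_power m n X f (\<gamma> ^ n) \<le> ennreal (960 * r * real n)"
      by (rule ennreal_le_epsilon)
    also have "960 * r * real n = 960 * real n * r" by simp
    also have "ennreal \<dots> = ennreal 960 * of_nat n * R_single m X f \<gamma>"
      unfolding r(1) ennreal_of_nat_eq_real_of_nat using r(2) by (simp only: ennreal_mult)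
    finally show ?thesis .
  qed
qed

theorem theorem1p1:
  "(\<exists>c\<^sub>1::real. c\<^sub>1 > 0 \<and>
      (\<forall>(m::nat) X (f :: (nat \<Rightarrow> bool) \<Rightarrow> bool) (\<gamma>::real) (n::nat).
         X \<subseteq> {..<m} \<rightarrow>\<^sub>E UNIV \<longrightarrow> 1/2 < \<gamma> \<longrightarrow> \<gamma> < 1 \<longrightarrow> n \<ge> 1 \<longrightarrow>
         R_power m n X f (\<gamma> ^ n) \<ge> ennreal c\<^sub>1 * of_nat n * R_single m X f \<gamma>))
   \<and>
   (\<exists>c C::real. c > 0 \<and> C > 0 \<and>
      (\<forall>(m::nat) X (f :: (nat \<Rightarrow> bool) \<Rightarrow> bool) (\<gamma>::real) (n::nat).
         X \<subseteq> {..<m} \<rightarrow>\<^sub>E UNIV \<longrightarrow> 1/2 < \<gamma> \<longrightarrow> \<gamma> < 1 \<longrightarrow>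
         real n \<ge> c / (min (2 * \<gamma> - 1) (1 - \<gamma>))\<^sup>2 \<longrightarrow>
         R_power m n X f (\<gamma> ^ n) \<le> ennreal C * of_nat n * R_single m X f \<gamma>))"
proof (intro conjI)
  show "\<exists>c\<^sub>1::real. c\<^sub>1 > 0 \<and>
      (\<forall>(m::nat) X (f :: (nat \<Rightarrow> bool) \<Rightarrow> bool) (\<gamma>::real) (n::nat).
         X \<subseteq> {..<m} \<rightarrow>\<^sub>E UNIV \<longrightarrow> 1/2 < \<gamma> \<longrightarrow> \<gamma> < 1 \<longrightarrow> n \<ge> 1 \<longrightarrow>
         R_power m n X f (\<gamma> ^ n) \<ge> ennreal c\<^sub>1 * of_nat n * R_single m X f \<gamma>)"
    by (intro exI[of _ "1/240"] conjI allI impI R_power_ge) auto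
  show "\<exists>c C::real. c > 0 \<and> C > 0 \<and>
      (\<forall>(m::nat) X (f :: (nat \<Rightarrow> bool) \<Rightarrow> bool) (\<gamma>::real) (n::nat).
         X \<subseteq> {..<m} \<rightarrow>\<^sub>E UNIV \<longrightarrow> 1/2 < \<gamma> \<longrightarrow> \<gamma> < 1 \<longrightarrow>
         real n \<ge> c / (min (2 * \<gamma> - 1) (1 - \<gamma>))\<^sup>2 \<longrightarrow>
         R_power m n X f (\<gamma> ^ n) \<le> ennreal C * of_nat n * R_single m X f \<gamma>)"
    by (intro exI[of _ 80] exI[of _ 960] conjI allI impI R_power_le) auto
qed

end
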